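(* Let $\mathcal P$ be a grand preference on $\mathfrak H$ satisfying the six axioms (weak order, continuity, dynamic consistency, terminal compatibility, compensated consumption monotonicity, weak separability), and fix a compatible utility system $\mathbf U$ for $\mathcal P$ satisfying certainty-equivalent richness. Let $\mathcal V^*$ be a PA recursive structure on the canonical PA-state system $\mathfrak X^*$ such that $(\mathfrak X^*,\mathcal V^* )$ factorizes $\mathbf U$ with the canonical projections as summary maps. Suppose the canonical PA-state system is rectangular, and fix a rectangularization of $\mathfrak X^*$ (together with the selected aggregators in $\mathcal V^*$). If aggregator exhaustiveness holds, then there exist an SPA-state system $\mathfrak X^\dagger$ and an SPA recursive structure $\mathcal V^\dagger$ on $\mathfrak X^\dagger$ such that $(\mathfrak X^\dagger,\mathcal V^\dagger)$ factorizes the same compatible utility system $\mathbf U$. Consequently, $(\mathfrak X^\dagger,\mathcal V^\dagger)$ represents $\mathcal P$.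
   Context: **Primitives.** For an integer $n\ge 0$, $[n]=\{0,1,\dots,n\}$. $T\ge 1$ is an integer horizon. $\mathcal S$ is a finite nonempty set (discrete topology); $\mathcal S_0=\{\bar s_0\}$ is a singleton, $\mathcal S_t=\mathcal S$ for $1\le t\le T$, $\mathcal S_{T+1}=\{\star\}$. $\mathcal C=[0,\bar c]\subset\mathbb R_{\ge 0}$ is a compact interval. Histories: $\mathcal H_0=\{\bar s_0\}$, $\mathcal H_t=\mathcal H_{t-1}\times\mathcal C\times\mathcal S_t$ for $1\le t\le T$, $\mathcal H_{T+1}=\mathcal H_T\times\mathcal C$, with product topologies (compact metrizable). Extension maps $\iota_t:\mathcal H_t\times\mathcal C\times\mathcal S_{t+1}\to\mathcal H_{t+1}$: $\iota_t(h_t,c,s)=(h_t,c,s)$ for $t\in[T-1]$, $\iota_T(h_T,c,\star)=(h_T,c)$. Physical-state projections $\sigma^s_t:\mathcal H_t\to\mathcal S_t$: $\sigma_t^s(h_t)$ is the last state $s_t$ of $h_t$ for $t\in[T]$, and $\sigma^s_{T+1}\equiv\star$. $\mathfrak H=(\{\mathcal H_t\},\{\sigma^s_t\},\{\iota_t\})$. Plans: $\mathcal F_{T+1}=\{\emptyset\}$ and $\mathcal F_t=\mathcal C\times(\mathcal F_{t+1})^{\mathcal S}$ for $t\in[T]$ (product topology); $\mathcal F_T$ is identified with $\mathcal C$. For $t\in[T-1]$ a plan is written $f=(c,f_+)$ with $c\in\mathcal C$, $f_+:\mathcal S\to\mathcal F_{t+1}$. $\mathcal D_t=\mathcal H_t\times\mathcal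 F_t$. **Preferences.** A grand preference on $\mathfrak H$ is $\mathcal P=(\{\succeq_{(t)}\}_{t=0}^T,V_{T+1})$ with $\succeq_{(t)}$ a binary relation on $\mathcal D_t$ and $V_{T+1}:\mathcal H_{T+1}\to\mathbb R$ continuous; $\succ_{(t)},\sim_{(t)}$ denote its strict part and indifference. Conditional preference: $f\succeq_{h_t}g$ iff $(h_t,f)\succeq_{(t)}(h_t,g)$. A utility system is $\mathbf U=\{U_t\}_{t=0}^{T+1}$ with $U_t:\mathcal H_t\times\mathcal F_t\to\mathbb R$ ($t\in[T]$) and $U_{T+1}:\mathcal H_{T+1}\to\mathbb R$ continuous. It is compatible with $\mathcal P$ if $U_{T+1}=V_{T+1}$; $U_T(h_T,c)=U_{T+1}(\iota_T(h_T,c,\star))$ for all $h_T,c$; and for all $t\in[T]$, $U_t(h_t,f)\ge U_t(h_t',g)\iff(h_t,f)\succeq_{(t)}(h_t',g)$. **Axioms.** (1) Weak order: each $\succeq_{(t)}$, $t\in[T]$, is complete and transitive. (2) Continuity: for each $t\in[T]$ and $(h_t,f)\in\mathcal D_t$, the sets $\{(h_t',g):(h_t',g)\succeq_{(t)}(h_t,f)\}$ and $\{(h_t',g):(h_t,f)\succeq_{(t)}(h_t',g)\}$ are closed in $\mathcal D_t$. (3) Dynamic consistency: for $t\in[T-1]$, $h_t$, $c$, and $f=(c,f_+),g=(c,g_+)\in\mathcal F_t$, if $(\iota_t(h_t,c,s),f_+(s))\succeq_{(t+1)}(\iota_t(h_t,c,s),g_+(s))$ for all $s\in\mathcal S$,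 then $(h_t,f)\succeq_{(t)}(h_t,g)$. (4) Terminal compatibility: $(h_T,c)\succeq_{(T)}(h_T',c')$ iff $V_{T+1}((h_T,c))\ge V_{T+1}((h_T',c'))$. (5) Compensated consumption monotonicity: for $t\in[T-1]$, $h_t$, $c>c'$ in $\mathcal C$, $f_+,g_+\in(\mathcal F_{t+1})^{\mathcal S}$, if $(\iota_t(h_t,c,s),f_+(s))\sim_{(t+1)}(\iota_t(h_t,c',s),g_+(s))$ for all $s\in\mathcal S$, then $(h_t,(c,f_+))\succ_{(t)}(h_t,(c',g_+))$. (6) Weak separability: for $t\in[T-1]$, $h_t$, $c,c'\in\mathcal C$, $f_+,g_+,f_+',g_+'\in(\mathcal F_{t+1})^{\mathcal S}$, if $(\iota_t(h_t,c,s),f_+(s))\sim_{(t+1)}(\iota_t(h_t,c',s),f'_+(s))$ and $(\iota_t(h_t,c,s),g_+(s))\sim_{(t+1)}(\iota_t(h_t,c',s),g'_+(s))$ for all $s\in\mathcal S$, then $(h_t,(c,f_+))\succeq_{(t)}(h_t,(c,g_+))\iff(h_t,(c',f'_+))\succeq_{(t)}(h_t,(c',g'_+))$. **Certainty-equivalent richness of $\mathbf U$.** Let $\mathcal L=\mathbb R^{\mathcal S}$ with sup norm and pointwise order; for $v\in\mathbb R$, $\mathbf v\in\mathcal L$ is the constant vector. For $t\in[T-1]$ and $f=(c,f_+)\in\mathcal F_t$ let $[\tilde u_{t+1}(h_t,f)](s)=U_{t+1}(\iota_t(h_t,c,s),f_+(s))$, $s\in\mathcal S$. Let $\Lambda_t^{\mathbf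 U}(h_t,c)=\{\tilde u_{t+1}(h_t,(c,f_+)):f_+\in(\mathcal F_{t+1})^{\mathcal S}\}$, $\Lambda_t^{\mathbf U}(h_t)=\bigcup_{c\in\mathcal C}\Lambda_t^{\mathbf U}(h_t,c)$, $D_t^M=\{(h_t,\tilde u):\tilde u\in\Lambda_t^{\mathbf U}(h_t)\}$. Richness: for every $t\in[T-1]$ there is a jointly continuous $M_t^0:D_t^M\to\mathbb R$ such that for each $h_t$: (i) for $f=(c,f_+),g=(c,g_+)\in\mathcal F_t$ with the same $c$, $f\succeq_{h_t}g$ iff $M_t^0(h_t,\tilde u_{t+1}(h_t,f))\ge M_t^0(h_t,\tilde u_{t+1}(h_t,g))$, and $M_t^0(h_t,\mathbf v)=v$ whenever $\mathbf v\in\Lambda_t^{\mathbf U}(h_t)$; (ii) $\min_s\tilde u(s)\le M_t^0(h_t,\tilde u)\le\max_s\tilde u(s)$ for $\tilde u\in\Lambda_t^{\mathbf U}(h_t)$; (iii) for every $f=(c,f_+)\in\mathcal F_t$, with $v=M_t^0(h_t,\tilde u_{t+1}(h_t,f))$, there is $(c,g_+)\in\mathcal F_t$ with $\tilde u_{t+1}(h_t,(c,g_+))=\mathbf v$; (iv) if $\tilde u\le\tilde v$ in $\Lambda_t^{\mathbf U}(h_t)$ then $M_t^0(h_t,\tilde u)\le M_t^0(h_t,\tilde v)$. **PA-state systems.** A PA-state system is $\mathfrak X=(\{\mathcal X_t\}_{t=0}^{T+1},\{\varsigma_t\}_{t=0}^{T+1},\{\Gamma_t\}_{t=0}^{T})$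 with $\mathcal X_t$ nonempty compact metrizable, $\varsigma_t:\mathcal X_t\to\mathcal S_t$ continuous, and $\Gamma_t:\mathcal X_t\times\mathcal C\times\mathcal S_{t+1}\to\mathcal X_{t+1}$ continuous with $\varsigma_{t+1}(\Gamma_t(x,c,s'))=s'$. A PA recursive structure on $\mathfrak X$ is $\mathcal V^*=(\{W_t^*\}_{t=0}^{T-1},\{M_t^*\}_{t=0}^{T-1},V_{T+1}^* )$ where $W_t^*:\mathcal X_t\times\mathcal C\times\mathbb R\to\mathbb R$ is jointly continuous and nondecreasing in its last argument; $M_t^*:\mathcal X_t\times\mathcal L\to\mathbb R$ is jointly continuous, monotone in $\tilde u\in\mathcal L$, and $M_t^*(x,\mathbf v)=v$ for all $x$, $v\in\mathbb R$; $V_{T+1}^*:\mathcal X_{T+1}\to\mathbb R$ is continuous. $(\mathfrak X,\mathcal V^* )$ generates $\{U_t^*\}$: $U_{T+1}^*=V_{T+1}^*$, $U_T^*(x_T,c)=U_{T+1}^*(\Gamma_T(x_T,c,\star))$, and for $t\in[T-1]$, $f=(c,f_+)$, $U_t^*(x_t,f)=W_t^*(x_t,c,M_t^*(x_t,\tilde u^*_{t+1}(x_t,f)))$ with $[\tilde u^*_{t+1}(x_t,f)](s)=U_{t+1}^*(\Gamma_t(x_t,c,s),f_+(s))$. It factorizes $\mathbf U$ through continuous summary maps $\sigma_t:\mathcal H_t\to\mathcal X_t$ if $\varsigma_t\circ\sigma_t=\sigma_t^s$ ($t\in[T+1]$), $U_{T+1}=U_{T+1}^*\circ\sigma_{T+1}$,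 $U_t(h_t,f)=U_t^*(\sigma_t(h_t),f)$ ($t\in[T]$), and $\sigma_{t+1}(\iota_t(h_t,c,s))=\Gamma_t(\sigma_t(h_t),c,s)$ for all $h_t,c,s\in\mathcal S_{t+1}$, $t\in[T]$. **Canonical PA-state system.** $h_{T+1}\odot_{T+1}h'_{T+1}$ iff $U_{T+1}(h_{T+1})=U_{T+1}(h_{T+1}')$; for $t\in[T]$, $h_t\odot_th_t'$ iff (i) $\sigma_t^s(h_t)=\sigma_t^s(h'_t)$, (ii) $(h_t,f)\sim_{(t)}(h_t',f)$ for all $f\in\mathcal F_t$, and (iii) $\iota_t(h_t,c,s)\odot_{t+1}\iota_t(h_t',c,s)$ for all $c\in\mathcal C$, $s\in\mathcal S_{t+1}$. These are equivalence relations. $\mathfrak X^*$ consists of $\mathcal X_t=\mathcal H_t/\odot_t$ (quotient topology, canonical projection $\sigma_t$), $\varsigma_t$ with $\varsigma_t\circ\sigma_t=\sigma_t^s$, and $\Gamma_t$ with $\Gamma_t(\sigma_t(h_t),c,s')=\sigma_{t+1}(\iota_t(h_t,c,s'))$; these are well defined and form a PA-state system. **Rectangularity.** $\mathfrak X^*$ is rectangular if for every $t\in[T+1]$ there are a compact metrizable space $\mathcal M_t$ and a homeomorphism $\kappa_t:\mathcal X_t\to\mathcal S_t\times\mathcal M_t$ with $\mathrm{pr}_{\mathcal S_t}\circ\kappa_t=\varsigma_t$. A choice $\{(\mathcal M_t,\kappa_t)\}$ is a rectangularization; one identifies $\mathcal X_t$ with $\mathcal S_t\times\mathcal M_t$ and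 writes $M_t^*(s,m,\tilde u)$, $W_t^*(s,m,c,v)$. **Belief/taste equivalence and exhaustiveness.** For $t\in[T-1]$ and $m,m'\in\mathcal M_t$: $m\sim_t^ym'$ iff $M_t^*(s,m,\tilde u)=M_t^*(s,m',\tilde u)$ for all $s\in\mathcal S_t$, $\tilde u\in\mathcal L$; $m\sim_t^zm'$ iff $W_t^*(s,m,c,v)=W_t^*(s,m',c,v)$ for all $s\in\mathcal S_t$, $c\in\mathcal C$, $v\in\mathbb R$. For $t\in\{T,T+1\}$: $m\sim_t^ym'$ always, and $m\sim_t^zm'$ iff $m=m'$. Aggregator exhaustiveness: for every $t\in[T+1]$, $m\sim_t^ym'$ and $m\sim_t^zm'$ imply $m=m'$. **SPA-state systems.** An SPA-state system is $\mathfrak X^\dagger=(\{\mathcal Y_t\}_{t=0}^{T+1},\{\mathcal Z_t\}_{t=0}^{T+1},\{\mathcal X_t^\dagger\}_{t=0}^{T+1},\{\varsigma_t^\dagger\}_{t=0}^{T+1},\{\Gamma_t^\dagger\}_{t=0}^{T})$ with $\mathcal Y_t,\mathcal Z_t$ Hausdorff spaces, $\mathcal X_t^\dagger\subseteq\mathcal S_t\times\mathcal Y_t\times\mathcal Z_t$ a nonempty compact metrizable subspace with elements $\xi_t=(s_t,y_t,z_t)$, $\varsigma_t^\dagger(\xi_t)=s_t$, and $\Gamma_t^\dagger:\mathcal X_t^\dagger\times\mathcal C\times\mathcal S_{t+1}\to\mathcal X_{t+1}^\dagger$ continuous with $\varsigma_{t+1}^\dagger(\Gamma_t^\dagger(\xi_t,c,s'))=s'$.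 Let $\mathcal X_t^{\dagger,y}\subseteq\mathcal S_t\times\mathcal Y_t$ and $\mathcal X_t^{\dagger,z}\subseteq\mathcal S_t\times\mathcal Z_t$ be the images of $\mathcal X_t^\dagger$ under $\xi_t\mapsto(s_t,y_t)$ and $\xi_t\mapsto(s_t,z_t)$. An SPA recursive structure is $\mathcal V^\dagger=(\{W_t^\dagger\}_{t=0}^{T-1},\{M_t^\dagger\}_{t=0}^{T-1},V_{T+1}^\dagger)$ with $W_t^\dagger:\mathcal X_t^{\dagger,z}\times\mathcal C\times\mathbb R\to\mathbb R$ jointly continuous and nondecreasing in its last argument; $M_t^\dagger:\mathcal X_t^{\dagger,y}\times\mathcal L\to\mathbb R$ jointly continuous, monotone in $\tilde u$, with $M_t^\dagger(s,y,\mathbf v)=v$ for all $v\in\mathbb R$; $V_{T+1}^\dagger:\mathcal X_{T+1}^\dagger\to\mathbb R$ continuous. It generates $U_{T+1}^\dagger=V_{T+1}^\dagger$, $U_T^\dagger(\xi_T,c)=U_{T+1}^\dagger(\Gamma_T^\dagger(\xi_T,c,\star))$, and for $t\in[T-1]$, $f=(c,f_+)$, $U_t^\dagger(\xi_t,f)=W_t^\dagger(s_t,z_t,c,M_t^\dagger(s_t,y_t,\tilde u^\dagger_{t+1}(\xi_t,f)))$ with $[\tilde u^\dagger_{t+1}(\xi_t,f)](s)=U_{t+1}^\dagger(\Gamma_t^\dagger(\xi_t,c,s),f_+(s))$. $(\mathfrak X^\dagger,\mathcal V^\dagger)$ factorizes $\mathbf U$ if for all $t\in[T+1]$ there are continuous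 $\sigma_t^y:\mathcal H_t\to\mathcal Y_t$, $\sigma_t^z:\mathcal H_t\to\mathcal Z_t$ such that $\sigma_t^\dagger:=(\sigma_t^s,\sigma_t^y,\sigma_t^z)$ takes values in $\mathcal X_t^\dagger$, $U_{T+1}=U_{T+1}^\dagger\circ\sigma_{T+1}^\dagger$, $U_t(h_t,f)=U_t^\dagger(\sigma_t^\dagger(h_t),f)$ ($t\in[T]$), and $\sigma_{t+1}^\dagger(\iota_t(h_t,c,s))=\Gamma_t^\dagger(\sigma_t^\dagger(h_t),c,s)$ for all $h_t,c,s\in\mathcal S_{t+1}$, $t\in[T]$. If it factorizes a compatible utility system for $\mathcal P$, it is said to represent $\mathcal P$. *)

theory Defs
  imports "HOL-Analysis.Analysis"
begin

section \<open>States, histories and plans\<close>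

text \<open>
  The state space \<open>\<S>\<close> is the finite type \<open>'s\<close>.  The type \<open>'s pstate\<close> collects the elements of all
  the \<open>\<S>\<^sub>t\<close>: \<open>Init\<close> is the initial state and \<open>Star\<close> the formal state after the horizon.
  Throughout, \<open>T\<close> is the horizon and \<open>cb\<close> the upper end of the consumption interval.
\<close>

datatype 's pstate = Init | Phys 's | Star

definition states :: "nat \<Rightarrow> nat \<Rightarrow> 's pstate set" where
  "states T t = (if t = 0 then {Init} else if t \<le> T then range Phys else {Star})"

definition cons_top :: "real \<Rightarrow> real topology" where
  "cons_top cb = top_of_set {0..cb}"

definition state_top :: "nat \<Rightarrow> nat \<Rightarrow> 's pstate topology" where
  "state_top T t = discrete_topology (states T t)"

datatype 's hist =
    Root
  | Step (prev: "'s hist") (hcons: real) (hstate: 's)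
  | Final (prev: "'s hist") (hcons: real)

fun phys_state :: "'s hist \<Rightarrow> 's pstate" where
  "phys_state Root = Init"
| "phys_state (Step h c s) = Phys s"
| "phys_state (Final h c) = Star"

text \<open>The value at \<open>Init\<close> is a dummy, since \<open>Init\<close> belongs to no \<open>\<S>\<^sub>t\<^sub>+\<^sub>1\<close>.\<close>

fun hext :: "'s hist \<Rightarrow> real \<Rightarrow> 's pstate \<Rightarrow> 's hist" where
  "hext h c (Phys s) = Step h c s"
| "hext h c Star = Final h c"
| "hext h c Init = Root"

text \<open>
  The pullbacks transport the product topologies along the bijections
  \<open>Step h c s \<leftrightarrow> (h, c, s)\<close> and \<open>Final h c \<leftrightarrow> (h, c)\<close>.
\<close>

primrec hist_top :: "nat \<Rightarrow> real \<Rightarrow> nat \<Rightarrow> 's hist topology" where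
  "hist_top T cb 0 = discrete_topology {Root}"
| "hist_top T cb (Suc t) =
     (if t < T
      then pullback_topology {h. is_Step h} (\<lambda>h. (prev h, hcons h, hstate h))
             (prod_topology (hist_top T cb t)
               (prod_topology (cons_top cb) (discrete_topology UNIV)))
      else pullback_topology {h. is_Final h} (\<lambda>h. (prev h, hcons h))
             (prod_topology (hist_top T cb t) (cons_top cb)))"

abbreviation hists :: "nat \<Rightarrow> real \<Rightarrow> nat \<Rightarrow> 's hist set" where
  "hists T cb t \<equiv> topspace (hist_top T cb t)"

datatype 's plan = Done | Plan (now: real) (later: "'s \<Rightarrow> 's plan")

text \<open>In \<open>plan_top_rem cb n\<close> the argument \<open>n\<close> is the number \<open>T + 1 - t\<close> of remaining choices.\<close>

primrec plan_top_rem :: "real \<Rightarrow> nat \<Rightarrow> 's plan topology" where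
  "plan_top_rem cb 0 = discrete_topology {Done}"
| "plan_top_rem cb (Suc n) =
     pullback_topology {f. f \<noteq> Done} (\<lambda>f. (now f, later f))
       (prod_topology (cons_top cb) (product_topology (\<lambda>_. plan_top_rem cb n) UNIV))"

definition plan_top :: "nat \<Rightarrow> real \<Rightarrow> nat \<Rightarrow> 's plan topology" where
  "plan_top T cb t = plan_top_rem cb (T + 1 - t)"

abbreviation plans :: "nat \<Rightarrow> real \<Rightarrow> nat \<Rightarrow> 's plan set" where
  "plans T cb t \<equiv> topspace (plan_top T cb t)"

text \<open>The identification of \<open>\<F>\<^sub>T\<close> with the consumption interval.\<close>

abbreviation last_plan :: "real \<Rightarrow> 's plan" where
  "last_plan c \<equiv> Plan c (\<lambda>_. Done)"

definition dom_top :: "nat \<Rightarrow> real \<Rightarrow> nat \<Rightarrow> ('s hist \<times> 's plan) topology" where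
  "dom_top T cb t = prod_topology (hist_top T cb t) (plan_top T cb t)"

text \<open>
  The space \<open>\<L>\<close> of real vectors indexed by states; as \<open>'s\<close> is finite, the product topology
  is the topology of the sup norm (lemma \<open>openin_lvec_top\<close>).
\<close>

definition lvec_top :: "('s \<Rightarrow> real) topology" where
  "lvec_top = product_topology (\<lambda>_. euclideanreal) UNIV"

lemma topspace_cons_top [simp]: "topspace (cons_top cb) = {0..cb}"
  by (simp add: cons_top_def)

lemma hists_0: "hists T cb 0 = {Root}"
  by simp

lemma hists_Suc: "t < T \<Longrightarrow> hists T cb (Suc t) = {Step h c s | h c s. h \<in> hists T cb t \<and> c \<in> {0..cb}}"
  by (auto simp: topspace_pullback_topology is_Step_def)

lemma hists_end: "hists T cb (Suc T) = {Final h c | h c. h \<in> hists T cb T \<and> c \<in> {0..cb}}"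
  by (auto simp: topspace_pullback_topology is_Final_def)

lemma plans_end: "plans T cb (T + 1) = {Done}"
  by (simp add: plan_top_def)

lemma plans_step:
  assumes "t \<le> T"
  shows "plans T cb t = {Plan c f | c f. c \<in> {0..cb} \<and> (\<forall>s. f s \<in> plans T cb (Suc t))}"
proof -
  have *: "T + 1 - t = Suc (T + 1 - Suc t)" using assms by simp
  have "f \<in> plans T cb t \<longleftrightarrow> f \<in> {Plan c f | c f. c \<in> {0..cb} \<and> (\<forall>s. f s \<in> plans T cb (Suc t))}"
    for f :: "'a plan"
    unfolding plan_top_def * by (cases f) (auto simp: topspace_pullback_topology PiE_iff)
  then show ?thesis by blast
qed

lemma plans_T: "plans T cb T = {last_plan c | c. c \<in> {0..cb}}"
proof -
  have "(\<forall>s. f s \<in> plans T cb (Suc T)) \<longleftrightarrow> f = (\<lambda>_. Done)" for f :: "'a \<Rightarrow> 'a plan"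
    using plans_end[of T cb, where 'a='a] by (auto simp: fun_eq_iff)
  then show ?thesis by (auto simp: plans_step)
qed

lemma openin_lvec_top:
  fixes U :: "('s::finite \<Rightarrow> real) set"
  shows "openin lvec_top U \<longleftrightarrow>
    (\<forall>u\<in>U. \<exists>e>0. \<forall>v. Max (range (\<lambda>s. \<bar>v s - u s\<bar>)) < e \<longrightarrow> v \<in> U)"
proof -
  have Max: "Max (range (\<lambda>s. \<bar>v s - u s\<bar>)) < e \<longleftrightarrow> (\<forall>s. \<bar>v s - u s\<bar> < e)" for u v :: "'s \<Rightarrow> real" and e
    by (subst Max_less_iff) auto
  show ?thesis
    unfolding Max lvec_top_def
  proof
    assume U: "openin (product_topology (\<lambda>_. euclideanreal) UNIV) U"
    show "\<forall>u\<in>U. \<exists>e>0. \<forall>v. (\<forall>s. \<bar>v s - u s\<bar> < e) \<longrightarrow> v \<in> U"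
    proof
      fix u assume "u \<in> U"
      then have "\<exists>B. (\<forall>i. open (B i)) \<and> u \<in> Pi\<^sub>E UNIV B \<and> Pi\<^sub>E UNIV B \<subseteq> U"
        using U by (simp add: openin_product_topology_alt)
      then obtain B where B: "\<forall>i. open (B i)" "u \<in> Pi\<^sub>E UNIV B" "Pi\<^sub>E UNIV B \<subseteq> U"
        by (elim exE conjE) (rule that)
      have "\<forall>i. \<exists>e>0. ball (u i) e \<subseteq> B i"
      proof
        fix i
        have "open (B i)" and "u i \<in> B i" using B(1,2) by (simp_all add: PiE_iff)
        then show "\<exists>e>0. ball (u i) e \<subseteq> B i" by (rule openE) (intro exI conjI)
      qed
      then have "\<exists>e. \<forall>i. e i > 0 \<and> ball (u i) (e i) \<subseteq> B i" by (rule choice)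
      then obtain e where e0: "\<forall>i. e i > 0 \<and> ball (u i) (e i) \<subseteq> B i" by (rule exE)
      have e: "e i > 0" "ball (u i) (e i) \<subseteq> B i" for i using e0 by simp_all
      have "Min (range e) > 0" using e(1) by (simp add: Min_gr_iff)
      moreover have "v \<in> U" if v: "\<forall>s. \<bar>v s - u s\<bar> < Min (range e)" for v
      proof -
        have "v i \<in> B i" for i
        proof -
          have "Min (range e) \<le> e i" by (rule Min_le) auto
          with v[rule_format] have "\<bar>v i - u i\<bar> < e i" by (rule less_le_trans)
          then have "v i \<in> ball (u i) (e i)" by (simp add: dist_real_def abs_minus_commute[of "u i"])
          then show ?thesis using e(2) by (rule subsetD[rotated])
        qed
        then have "v \<in> Pi\<^sub>E UNIV B" by (simp add: PiE_iff)
        then show ?thesis using B(3) by (rule subsetD[rotated])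
      qed
      ultimately show "\<exists>e>0. \<forall>v. (\<forall>s. \<bar>v s - u s\<bar> < e) \<longrightarrow> v \<in> U"
        by (intro exI[of _ "Min (range e)"] conjI allI impI)
    qed
  next
    assume U: "\<forall>u\<in>U. \<exists>e>0. \<forall>v. (\<forall>s. \<bar>v s - u s\<bar> < e) \<longrightarrow> v \<in> U"
    have "\<exists>B. (\<forall>i. open (B i)) \<and> u \<in> Pi\<^sub>E UNIV B \<and> Pi\<^sub>E UNIV B \<subseteq> U"
      if "u \<in> U" for u
    proof -
      have "\<exists>e>0. \<forall>v. (\<forall>s. \<bar>v s - u s\<bar> < e) \<longrightarrow> v \<in> U" using U that by (rule bspec)
      then obtain e where "e > 0" and e: "\<forall>v. (\<forall>s. \<bar>v s - u s\<bar> < e) \<longrightarrow> v \<in> U"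
        by (elim exE conjE) (rule that)
      have "Pi\<^sub>E UNIV (\<lambda>i. ball (u i) e) \<subseteq> U"
      proof
        fix v assume "v \<in> Pi\<^sub>E UNIV (\<lambda>i. ball (u i) e)"
        then have "\<forall>s. \<bar>v s - u s\<bar> < e"
          by (simp add: PiE_iff dist_real_def abs_minus_commute[of "u _"])
        then show "v \<in> U" by (rule mp[OF spec[OF e]])
      qed
      moreover have "u \<in> Pi\<^sub>E UNIV (\<lambda>i. ball (u i) e)" using \<open>e > 0\<close> by (simp add: PiE_iff)
      ultimately show ?thesis
        by (intro exI[of _ "\<lambda>i. ball (u i) e"] conjI allI open_ball)
    qed
    then have "\<forall>u\<in>U. \<exists>B. (\<forall>i. open (B i)) \<and> u \<in> Pi\<^sub>E UNIV B \<and> Pi\<^sub>E UNIV B \<subseteq> U" by (rule ballI)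
    then show "openin (product_topology (\<lambda>_. euclideanreal) UNIV) U"
      by (simp add: openin_product_topology_alt)
  qed
qed

section \<open>Preferences and utility systems\<close>

text \<open>
  The relation \<open>pref P t\<close> is only ever used on \<open>\<D>\<^sub>t\<close>, and \<open>pref_end P\<close> (the function
  \<open>V\<^sub>T\<^sub>+\<^sub>1\<close>) only on terminal histories; similarly for \<open>util\<close> and \<open>util_end\<close>.
\<close>

record 's grand_pref =
  pref :: "nat \<Rightarrow> 's hist \<times> 's plan \<Rightarrow> 's hist \<times> 's plan \<Rightarrow> bool"
  pref_end :: "'s hist \<Rightarrow> real"

record 's utility =
  util :: "nat \<Rightarrow> 's hist \<Rightarrow> 's plan \<Rightarrow> real"
  util_end :: "'s hist \<Rightarrow> real"

definition grand_preference :: "nat \<Rightarrow> real \<Rightarrow> 's grand_pref \<Rightarrow> bool" where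
  "grand_preference T cb P \<longleftrightarrow> continuous_map (hist_top T cb (T + 1)) euclideanreal (pref_end P)"

definition strict :: "'s grand_pref \<Rightarrow> nat \<Rightarrow> 's hist \<times> 's plan \<Rightarrow> 's hist \<times> 's plan \<Rightarrow> bool" where
  "strict P t p q \<longleftrightarrow> pref P t p q \<and> \<not> pref P t q p"

definition indiff :: "'s grand_pref \<Rightarrow> nat \<Rightarrow> 's hist \<times> 's plan \<Rightarrow> 's hist \<times> 's plan \<Rightarrow> bool" where
  "indiff P t p q \<longleftrightarrow> pref P t p q \<and> pref P t q p"

definition cond_pref :: "'s grand_pref \<Rightarrow> nat \<Rightarrow> 's hist \<Rightarrow> 's plan \<Rightarrow> 's plan \<Rightarrow> bool" where
  "cond_pref P t h f g \<longleftrightarrow> pref P t (h, f) (h, g)"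

definition utility_system :: "nat \<Rightarrow> real \<Rightarrow> 's utility \<Rightarrow> bool" where
  "utility_system T cb U \<longleftrightarrow>
     (\<forall>t\<le>T. continuous_map (dom_top T cb t) euclideanreal (\<lambda>(h, f). util U t h f)) \<and>
     continuous_map (hist_top T cb (T + 1)) euclideanreal (util_end U)"

definition compatible :: "nat \<Rightarrow> real \<Rightarrow> 's grand_pref \<Rightarrow> 's utility \<Rightarrow> bool" where
  "compatible T cb P U \<longleftrightarrow>
     (\<forall>h\<in>hists T cb (T + 1). util_end U h = pref_end P h) \<and>
     (\<forall>h\<in>hists T cb T. \<forall>c\<in>{0..cb}. util U T h (last_plan c) = util_end U (hext h c Star)) \<and>
     (\<forall>t\<le>T. \<forall>h\<in>hists T cb t. \<forall>f\<in>plans T cb t. \<forall>h'\<in>hists T cb t. \<forall>g\<in>plans T cb t.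
        util U t h f \<ge> util U t h' g \<longleftrightarrow> pref P t (h, f) (h', g))"

subsection \<open>Axioms\<close>

definition weak_order :: "nat \<Rightarrow> real \<Rightarrow> 's grand_pref \<Rightarrow> bool" where
  "weak_order T cb P \<longleftrightarrow>
     (\<forall>t\<le>T.
       (\<forall>p\<in>topspace (dom_top T cb t). \<forall>q\<in>topspace (dom_top T cb t). pref P t p q \<or> pref P t q p) \<and>
       (\<forall>p\<in>topspace (dom_top T cb t). \<forall>q\<in>topspace (dom_top T cb t). \<forall>r\<in>topspace (dom_top T cb t).
          pref P t p q \<longrightarrow> pref P t q r \<longrightarrow> pref P t p r))"

definition pref_continuity :: "nat \<Rightarrow> real \<Rightarrow> 's grand_pref \<Rightarrow> bool" where
  "pref_continuity T cb P \<longleftrightarrow>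
     (\<forall>t\<le>T. \<forall>p\<in>topspace (dom_top T cb t).
       closedin (dom_top T cb t) {q \<in> topspace (dom_top T cb t). pref P t q p} \<and>
       closedin (dom_top T cb t) {q \<in> topspace (dom_top T cb t). pref P t p q})"

definition conts :: "nat \<Rightarrow> real \<Rightarrow> nat \<Rightarrow> ('s \<Rightarrow> 's plan) set" where
  "conts T cb t = {fp. \<forall>s. fp s \<in> plans T cb (Suc t)}"

definition dynamic_consistency :: "nat \<Rightarrow> real \<Rightarrow> 's grand_pref \<Rightarrow> bool" where
  "dynamic_consistency T cb P \<longleftrightarrow>
     (\<forall>t<T. \<forall>h\<in>hists T cb t. \<forall>c\<in>{0..cb}. \<forall>fp\<in>conts T cb t. \<forall>gp\<in>conts T cb t.
       (\<forall>s. pref P (Suc t) (hext h c (Phys s), fp s) (hext h c (Phys s), gp s)) \<longrightarrow>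
       pref P t (h, Plan c fp) (h, Plan c gp))"

definition terminal_compatibility :: "nat \<Rightarrow> real \<Rightarrow> 's grand_pref \<Rightarrow> bool" where
  "terminal_compatibility T cb P \<longleftrightarrow>
     (\<forall>h\<in>hists T cb T. \<forall>h'\<in>hists T cb T. \<forall>c\<in>{0..cb}. \<forall>c'\<in>{0..cb}.
       pref P T (h, last_plan c) (h', last_plan c') \<longleftrightarrow>
       pref_end P (Final h c) \<ge> pref_end P (Final h' c'))"

definition compensated_monotonicity :: "nat \<Rightarrow> real \<Rightarrow> 's grand_pref \<Rightarrow> bool" where
  "compensated_monotonicity T cb P \<longleftrightarrow>
     (\<forall>t<T. \<forall>h\<in>hists T cb t. \<forall>c\<in>{0..cb}. \<forall>c'\<in>{0..cb}. \<forall>fp\<in>conts T cb t. \<forall>gp\<in>conts T cb t.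
       c > c' \<longrightarrow>
       (\<forall>s. indiff P (Suc t) (hext h c (Phys s), fp s) (hext h c' (Phys s), gp s)) \<longrightarrow>
       strict P t (h, Plan c fp) (h, Plan c' gp))"

definition weak_separability :: "nat \<Rightarrow> real \<Rightarrow> 's grand_pref \<Rightarrow> bool" where
  "weak_separability T cb P \<longleftrightarrow>
     (\<forall>t<T. \<forall>h\<in>hists T cb t. \<forall>c\<in>{0..cb}. \<forall>c'\<in>{0..cb}.
       \<forall>fp\<in>conts T cb t. \<forall>gp\<in>conts T cb t. \<forall>fp'\<in>conts T cb t. \<forall>gp'\<in>conts T cb t.
       (\<forall>s. indiff P (Suc t) (hext h c (Phys s), fp s) (hext h c' (Phys s), fp' s)) \<longrightarrow>
       (\<forall>s. indiff P (Suc t) (hext h c (Phys s), gp s) (hext h c' (Phys s), gp' s)) \<longrightarrow>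
       (pref P t (h, Plan c fp) (h, Plan c gp) \<longleftrightarrow> pref P t (h, Plan c' fp') (h, Plan c' gp')))"

subsection \<open>Certainty-equivalent richness\<close>

definition cont_util :: "'s utility \<Rightarrow> nat \<Rightarrow> 's hist \<Rightarrow> 's plan \<Rightarrow> 's \<Rightarrow> real" where
  "cont_util U t h f = (\<lambda>s. util U (Suc t) (hext h (now f) (Phys s)) (later f s))"

definition Lam_cons :: "nat \<Rightarrow> real \<Rightarrow> 's utility \<Rightarrow> nat \<Rightarrow> 's hist \<Rightarrow> real \<Rightarrow> ('s \<Rightarrow> real) set" where
  "Lam_cons T cb U t h c = {cont_util U t h (Plan c fp) | fp. fp \<in> conts T cb t}"

definition Lam :: "nat \<Rightarrow> real \<Rightarrow> 's utility \<Rightarrow> nat \<Rightarrow> 's hist \<Rightarrow> ('s \<Rightarrow> real) set" where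
  "Lam T cb U t h = (\<Union>c\<in>{0..cb}. Lam_cons T cb U t h c)"

definition ce_domain :: "nat \<Rightarrow> real \<Rightarrow> 's utility \<Rightarrow> nat \<Rightarrow> ('s hist \<times> ('s \<Rightarrow> real)) set" where
  "ce_domain T cb U t = {(h, u). h \<in> hists T cb t \<and> u \<in> Lam T cb U t h}"

definition ce_richness :: "nat \<Rightarrow> real \<Rightarrow> ('s::finite) grand_pref \<Rightarrow> 's utility \<Rightarrow> bool" where
  "ce_richness T cb P U \<longleftrightarrow>
     (\<forall>t<T. \<exists>M0 :: 's hist \<Rightarrow> ('s \<Rightarrow> real) \<Rightarrow> real.
       continuous_map
         (subtopology (prod_topology (hist_top T cb t) lvec_top) (ce_domain T cb U t))
         euclideanreal (\<lambda>(h, u). M0 h u) \<and>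
       (\<forall>h\<in>hists T cb t.
         (\<forall>c\<in>{0..cb}. \<forall>fp\<in>conts T cb t. \<forall>gp\<in>conts T cb t.
            cond_pref P t h (Plan c fp) (Plan c gp) \<longleftrightarrow>
            M0 h (cont_util U t h (Plan c fp)) \<ge> M0 h (cont_util U t h (Plan c gp))) \<and>
         (\<forall>v. (\<lambda>_. v) \<in> Lam T cb U t h \<longrightarrow> M0 h (\<lambda>_. v) = v) \<and>
         (\<forall>u\<in>Lam T cb U t h. Min (range u) \<le> M0 h u \<and> M0 h u \<le> Max (range u)) \<and>
         (\<forall>c\<in>{0..cb}. \<forall>fp\<in>conts T cb t. \<exists>gp\<in>conts T cb t.
            cont_util U t h (Plan c gp) = (\<lambda>_. M0 h (cont_util U t h (Plan c fp)))) \<and>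
         (\<forall>u\<in>Lam T cb U t h. \<forall>v\<in>Lam T cb U t h. u \<le> v \<longrightarrow> M0 h u \<le> M0 h v)))"

section \<open>PA-state systems\<close>

record ('s, 'x) pa_sys =
  pa_space :: "nat \<Rightarrow> 'x topology"
  pa_state :: "nat \<Rightarrow> 'x \<Rightarrow> 's pstate"
  pa_trans :: "nat \<Rightarrow> 'x \<Rightarrow> real \<Rightarrow> 's pstate \<Rightarrow> 'x"

record ('s, 'x) pa_rec =
  pa_W :: "nat \<Rightarrow> 'x \<Rightarrow> real \<Rightarrow> real \<Rightarrow> real"
  pa_M :: "nat \<Rightarrow> 'x \<Rightarrow> ('s \<Rightarrow> real) \<Rightarrow> real"
  pa_V :: "'x \<Rightarrow> real"

definition pa_state_system :: "nat \<Rightarrow> real \<Rightarrow> ('s, 'x) pa_sys \<Rightarrow> bool" where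
  "pa_state_system T cb X \<longleftrightarrow>
     (\<forall>t\<le>T + 1. topspace (pa_space X t) \<noteq> {} \<and> compact_space (pa_space X t) \<and>
        metrizable_space (pa_space X t) \<and>
        continuous_map (pa_space X t) (state_top T t) (pa_state X t)) \<and>
     (\<forall>t\<le>T.
        continuous_map
          (prod_topology (pa_space X t) (prod_topology (cons_top cb) (state_top T (Suc t))))
          (pa_space X (Suc t)) (\<lambda>(x, c, s). pa_trans X t x c s) \<and>
        (\<forall>x\<in>topspace (pa_space X t). \<forall>c\<in>{0..cb}. \<forall>s\<in>states T (Suc t).
           pa_state X (Suc t) (pa_trans X t x c s) = s))"

definition pa_recursive_structure ::
    "nat \<Rightarrow> real \<Rightarrow> ('s, 'x) pa_sys \<Rightarrow> ('s, 'x) pa_rec \<Rightarrow> bool" where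
  "pa_recursive_structure T cb X V \<longleftrightarrow>
     (\<forall>t<T.
        continuous_map (prod_topology (pa_space X t) (prod_topology (cons_top cb) euclideanreal))
          euclideanreal (\<lambda>(x, c, v). pa_W V t x c v) \<and>
        (\<forall>x\<in>topspace (pa_space X t). \<forall>c\<in>{0..cb}. mono (pa_W V t x c)) \<and>
        continuous_map (prod_topology (pa_space X t) lvec_top)
          euclideanreal (\<lambda>(x, u). pa_M V t x u) \<and>
        (\<forall>x\<in>topspace (pa_space X t). mono (pa_M V t x)) \<and>
        (\<forall>x\<in>topspace (pa_space X t). \<forall>v. pa_M V t x (\<lambda>_. v) = v)) \<and>
     continuous_map (pa_space X (T + 1)) euclideanreal (pa_V V)"

text \<open>The generated utilities \<open>U\<^sub>t\<^sup>*\<close> for \<open>t \<le> T\<close>; the terminal one is \<open>pa_V V\<close> itself.\<close>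

function pa_util :: "nat \<Rightarrow> ('s, 'x) pa_sys \<Rightarrow> ('s, 'x) pa_rec \<Rightarrow> nat \<Rightarrow> 'x \<Rightarrow> 's plan \<Rightarrow> real" where
  "pa_util T X V t x f =
     (if t < T
      then pa_W V t x (now f)
             (pa_M V t x
               (\<lambda>s. pa_util T X V (Suc t) (pa_trans X t x (now f) (Phys s)) (later f s)))
      else pa_V V (pa_trans X T x (now f) Star))"
  by auto
termination by (relation "Wellfounded.measure (\<lambda>(T, X, V, t, x, f). T - t)") auto

declare pa_util.simps [simp del]

definition pa_factorizes ::
    "nat \<Rightarrow> real \<Rightarrow> ('s, 'x) pa_sys \<Rightarrow> ('s, 'x) pa_rec \<Rightarrow> 's utility \<Rightarrow> (nat \<Rightarrow> 's hist \<Rightarrow> 'x) \<Rightarrow> bool" where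
  "pa_factorizes T cb X V U \<sigma> \<longleftrightarrow>
     (\<forall>t\<le>T + 1. continuous_map (hist_top T cb t) (pa_space X t) (\<sigma> t) \<and>
        (\<forall>h\<in>hists T cb t. pa_state X t (\<sigma> t h) = phys_state h)) \<and>
     (\<forall>h\<in>hists T cb (T + 1). util_end U h = pa_V V (\<sigma> (T + 1) h)) \<and>
     (\<forall>t\<le>T. \<forall>h\<in>hists T cb t. \<forall>f\<in>plans T cb t. util U t h f = pa_util T X V t (\<sigma> t h) f) \<and>
     (\<forall>t\<le>T. \<forall>h\<in>hists T cb t. \<forall>c\<in>{0..cb}. \<forall>s\<in>states T (Suc t).
        \<sigma> (Suc t) (hext h c s) = pa_trans X t (\<sigma> t h) c s)"

subsection \<open>The canonical PA-state system\<close>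

function hist_equiv ::
    "nat \<Rightarrow> real \<Rightarrow> 's grand_pref \<Rightarrow> 's utility \<Rightarrow> nat \<Rightarrow> 's hist \<Rightarrow> 's hist \<Rightarrow> bool" where
  "hist_equiv T cb P U t h h' =
     (if t \<le> T
      then phys_state h = phys_state h' \<and>
           (\<forall>f\<in>plans T cb t. indiff P t (h, f) (h', f)) \<and>
           (\<forall>c\<in>{0..cb}. \<forall>s\<in>states T (Suc t). hist_equiv T cb P U (Suc t) (hext h c s) (hext h' c s))
      else util_end U h = util_end U h')"
  by auto
termination by (relation "Wellfounded.measure (\<lambda>(T, cb, P, U, t, h, h'). T + 1 - t)") auto

declare hist_equiv.simps [simp del]

definition hist_rel ::
    "nat \<Rightarrow> real \<Rightarrow> 's grand_pref \<Rightarrow> 's utility \<Rightarrow> nat \<Rightarrow> ('s hist \<times> 's hist) set" where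
  "hist_rel T cb P U t =
     {(h, h'). h \<in> hists T cb t \<and> h' \<in> hists T cb t \<and> hist_equiv T cb P U t h h'}"

definition quotient_top :: "'a topology \<Rightarrow> ('a \<times> 'a) set \<Rightarrow> 'a set topology" where
  "quotient_top X R =
     topology (\<lambda>Q. Q \<subseteq> topspace X // R \<and> openin X {x \<in> topspace X. R `` {x} \<in> Q})"

lemma openin_quotient_top:
  "openin (quotient_top X R) Q \<longleftrightarrow>
     Q \<subseteq> topspace X // R \<and> openin X {x \<in> topspace X. R `` {x} \<in> Q}"
proof -
  have "istopology (\<lambda>Q. Q \<subseteq> topspace X // R \<and> openin X {x \<in> topspace X. R `` {x} \<in> Q})"
    unfolding istopology_def
  proof (intro conjI allI impI)
    fix A B
    assume "A \<subseteq> topspace X // R \<and> openin X {x \<in> topspace X. R `` {x} \<in> A}"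
      and "B \<subseteq> topspace X // R \<and> openin X {x \<in> topspace X. R `` {x} \<in> B}"
    moreover have "{x \<in> topspace X. R `` {x} \<in> A \<inter> B} =
        {x \<in> topspace X. R `` {x} \<in> A} \<inter> {x \<in> topspace X. R `` {x} \<in> B}" by blast
    ultimately show "openin X {x \<in> topspace X. R `` {x} \<in> A \<inter> B}"
      by (simp add: openin_Int)
  next
    fix K
    assume K: "\<forall>A\<in>K. A \<subseteq> topspace X // R \<and> openin X {x \<in> topspace X. R `` {x} \<in> A}"
    have "{x \<in> topspace X. R `` {x} \<in> \<Union>K} = (\<Union>A\<in>K. {x \<in> topspace X. R `` {x} \<in> A})" by blast
    then show "openin X {x \<in> topspace X. R `` {x} \<in> \<Union>K}" using K by auto
  qed auto
  then show ?thesis by (simp add: quotient_top_def)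
qed

lemma topspace_quotient_top [simp]: "topspace (quotient_top X R) = topspace X // R"
proof -
  have "{x \<in> topspace X. R `` {x} \<in> topspace X // R} = topspace X" by (auto simp: quotient_def)
  then have "openin (quotient_top X R) (topspace X // R)" by (simp add: openin_quotient_top)
  then have "topspace X // R \<subseteq> topspace (quotient_top X R)" by (rule openin_subset)
  moreover have "topspace (quotient_top X R) \<subseteq> topspace X // R"
    using openin_topspace[of "quotient_top X R"] by (simp only: openin_quotient_top)
  ultimately show ?thesis by (rule subset_antisym[rotated])
qed

lemma quotient_map_quotient_top: "quotient_map X (quotient_top X R) (\<lambda>x. R `` {x})"
  by (auto simp: quotient_map_def openin_quotient_top quotient_def)

definition canon_proj ::
    "nat \<Rightarrow> real \<Rightarrow> 's grand_pref \<Rightarrow> 's utility \<Rightarrow> nat \<Rightarrow> 's hist \<Rightarrow> 's hist set" where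
  "canon_proj T cb P U t h = hist_rel T cb P U t `` {h}"

text \<open>
  The state and transition maps are defined through an arbitrary representative of the class.
\<close>

definition canon_sys ::
    "nat \<Rightarrow> real \<Rightarrow> 's grand_pref \<Rightarrow> 's utility \<Rightarrow> ('s, 's hist set) pa_sys" where
  "canon_sys T cb P U =
     \<lparr> pa_space = (\<lambda>t. quotient_top (hist_top T cb t) (hist_rel T cb P U t)),
       pa_state = (\<lambda>t x. phys_state (SOME h. h \<in> x)),
       pa_trans = (\<lambda>t x c s. canon_proj T cb P U (Suc t) (hext (SOME h. h \<in> x) c s)) \<rparr>"

subsection \<open>Rectangularity and aggregator exhaustiveness\<close>

definition rectangularization ::
    "nat \<Rightarrow> ('s, 'x) pa_sys \<Rightarrow> (nat \<Rightarrow> 'm topology) \<Rightarrow> (nat \<Rightarrow> 'x \<Rightarrow> 's pstate \<times> 'm) \<Rightarrow> bool" where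
  "rectangularization T X Mem \<kappa> \<longleftrightarrow>
     (\<forall>t\<le>T + 1. compact_space (Mem t) \<and> metrizable_space (Mem t) \<and>
        homeomorphic_map (pa_space X t) (prod_topology (state_top T t) (Mem t)) (\<kappa> t) \<and>
        (\<forall>x\<in>topspace (pa_space X t). fst (\<kappa> t x) = pa_state X t x))"

definition rect_inv ::
    "('s, 'x) pa_sys \<Rightarrow> (nat \<Rightarrow> 'x \<Rightarrow> 's pstate \<times> 'm) \<Rightarrow> nat \<Rightarrow> 's pstate \<Rightarrow> 'm \<Rightarrow> 'x" where
  "rect_inv X \<kappa> t s m = inv_into (topspace (pa_space X t)) (\<kappa> t) (s, m)"

definition belief_equiv ::
    "nat \<Rightarrow> ('s, 'x) pa_sys \<Rightarrow> ('s, 'x) pa_rec \<Rightarrow> (nat \<Rightarrow> 'x \<Rightarrow> 's pstate \<times> 'm) \<Rightarrow> nat \<Rightarrow> 'm \<Rightarrow> 'm \<Rightarrow> bool" where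
  "belief_equiv T X V \<kappa> t m m' \<longleftrightarrow>
     (if t < T
      then \<forall>s\<in>states T t. \<forall>u. pa_M V t (rect_inv X \<kappa> t s m) u = pa_M V t (rect_inv X \<kappa> t s m') u
      else True)"

definition taste_equiv ::
    "nat \<Rightarrow> real \<Rightarrow> ('s, 'x) pa_sys \<Rightarrow> ('s, 'x) pa_rec \<Rightarrow> (nat \<Rightarrow> 'x \<Rightarrow> 's pstate \<times> 'm) \<Rightarrow> nat \<Rightarrow> 'm \<Rightarrow> 'm \<Rightarrow> bool" where
  "taste_equiv T cb X V \<kappa> t m m' \<longleftrightarrow>
     (if t < T
      then \<forall>s\<in>states T t. \<forall>c\<in>{0..cb}. \<forall>v.
             pa_W V t (rect_inv X \<kappa> t s m) c v = pa_W V t (rect_inv X \<kappa> t s m') c v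
      else m = m')"

definition aggregator_exhaustive ::
    "nat \<Rightarrow> real \<Rightarrow> ('s, 'x) pa_sys \<Rightarrow> ('s, 'x) pa_rec \<Rightarrow> (nat \<Rightarrow> 'm topology) \<Rightarrow>
     (nat \<Rightarrow> 'x \<Rightarrow> 's pstate \<times> 'm) \<Rightarrow> bool" where
  "aggregator_exhaustive T cb X V Mem \<kappa> \<longleftrightarrow>
     (\<forall>t\<le>T + 1. \<forall>m\<in>topspace (Mem t). \<forall>m'\<in>topspace (Mem t).
        belief_equiv T X V \<kappa> t m m' \<longrightarrow> taste_equiv T cb X V \<kappa> t m m' \<longrightarrow> m = m')"

section \<open>SPA-state systems\<close>

record ('s, 'y, 'z) spa_sys =
  spa_Y :: "nat \<Rightarrow> 'y topology"
  spa_Z :: "nat \<Rightarrow> 'z topology"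
  spa_X :: "nat \<Rightarrow> ('s pstate \<times> 'y \<times> 'z) set"
  spa_state :: "nat \<Rightarrow> 's pstate \<times> 'y \<times> 'z \<Rightarrow> 's pstate"
  spa_trans :: "nat \<Rightarrow> 's pstate \<times> 'y \<times> 'z \<Rightarrow> real \<Rightarrow> 's pstate \<Rightarrow> 's pstate \<times> 'y \<times> 'z"

record ('s, 'y, 'z) spa_rec =
  spa_W :: "nat \<Rightarrow> 's pstate \<times> 'z \<Rightarrow> real \<Rightarrow> real \<Rightarrow> real"
  spa_M :: "nat \<Rightarrow> 's pstate \<times> 'y \<Rightarrow> ('s \<Rightarrow> real) \<Rightarrow> real"
  spa_V :: "'s pstate \<times> 'y \<times> 'z \<Rightarrow> real"

definition spa_space :: "nat \<Rightarrow> ('s, 'y, 'z) spa_sys \<Rightarrow> nat \<Rightarrow> ('s pstate \<times> 'y \<times> 'z) topology" where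
  "spa_space T X t =
     subtopology (prod_topology (state_top T t) (prod_topology (spa_Y X t) (spa_Z X t))) (spa_X X t)"

definition spa_y_space :: "nat \<Rightarrow> ('s, 'y, 'z) spa_sys \<Rightarrow> nat \<Rightarrow> ('s pstate \<times> 'y) topology" where
  "spa_y_space T X t =
     subtopology (prod_topology (state_top T t) (spa_Y X t)) ((\<lambda>(s, y, z). (s, y)) ` spa_X X t)"

definition spa_z_space :: "nat \<Rightarrow> ('s, 'y, 'z) spa_sys \<Rightarrow> nat \<Rightarrow> ('s pstate \<times> 'z) topology" where
  "spa_z_space T X t =
     subtopology (prod_topology (state_top T t) (spa_Z X t)) ((\<lambda>(s, y, z). (s, z)) ` spa_X X t)"

definition spa_state_system :: "nat \<Rightarrow> real \<Rightarrow> ('s, 'y, 'z) spa_sys \<Rightarrow> bool" where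
  "spa_state_system T cb X \<longleftrightarrow>
     (\<forall>t\<le>T + 1. Hausdorff_space (spa_Y X t) \<and> Hausdorff_space (spa_Z X t) \<and>
        spa_X X t \<subseteq> states T t \<times> topspace (spa_Y X t) \<times> topspace (spa_Z X t) \<and>
        spa_X X t \<noteq> {} \<and> compact_space (spa_space T X t) \<and> metrizable_space (spa_space T X t) \<and>
        (\<forall>\<xi>\<in>spa_X X t. spa_state X t \<xi> = fst \<xi>)) \<and>
     (\<forall>t\<le>T.
        continuous_map
          (prod_topology (spa_space T X t) (prod_topology (cons_top cb) (state_top T (Suc t))))
          (spa_space T X (Suc t)) (\<lambda>(\<xi>, c, s). spa_trans X t \<xi> c s) \<and>
        (\<forall>\<xi>\<in>spa_X X t. \<forall>c\<in>{0..cb}. \<forall>s\<in>states T (Suc t).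
           spa_state X (Suc t) (spa_trans X t \<xi> c s) = s))"

definition spa_recursive_structure ::
    "nat \<Rightarrow> real \<Rightarrow> ('s, 'y, 'z) spa_sys \<Rightarrow> ('s, 'y, 'z) spa_rec \<Rightarrow> bool" where
  "spa_recursive_structure T cb X V \<longleftrightarrow>
     (\<forall>t<T.
        continuous_map (prod_topology (spa_z_space T X t) (prod_topology (cons_top cb) euclideanreal))
          euclideanreal (\<lambda>(sz, c, v). spa_W V t sz c v) \<and>
        (\<forall>sz\<in>topspace (spa_z_space T X t). \<forall>c\<in>{0..cb}. mono (spa_W V t sz c)) \<and>
        continuous_map (prod_topology (spa_y_space T X t) lvec_top)
          euclideanreal (\<lambda>(sy, u). spa_M V t sy u) \<and>
        (\<forall>sy\<in>topspace (spa_y_space T X t). mono (spa_M V t sy)) \<and>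
        (\<forall>sy\<in>topspace (spa_y_space T X t). \<forall>v. spa_M V t sy (\<lambda>_. v) = v)) \<and>
     continuous_map (spa_space T X (T + 1)) euclideanreal (spa_V V)"

function spa_util ::
    "nat \<Rightarrow> ('s, 'y, 'z) spa_sys \<Rightarrow> ('s, 'y, 'z) spa_rec \<Rightarrow> nat \<Rightarrow>
     's pstate \<times> 'y \<times> 'z \<Rightarrow> 's plan \<Rightarrow> real" where
  "spa_util T X V t (s, y, z) f =
     (if t < T
      then spa_W V t (s, z) (now f)
             (spa_M V t (s, y)
               (\<lambda>s'. spa_util T X V (Suc t) (spa_trans X t (s, y, z) (now f) (Phys s')) (later f s')))
      else spa_V V (spa_trans X T (s, y, z) (now f) Star))"
  by auto
termination by (relation "Wellfounded.measure (\<lambda>(T, X, V, t, \<xi>, f). T - t)") auto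

declare spa_util.simps [simp del]

definition spa_factorizes ::
    "nat \<Rightarrow> real \<Rightarrow> ('s, 'y, 'z) spa_sys \<Rightarrow> ('s, 'y, 'z) spa_rec \<Rightarrow> 's utility \<Rightarrow> bool" where
  "spa_factorizes T cb X V U \<longleftrightarrow>
     (\<exists>\<sigma>y \<sigma>z \<sigma>.
        (\<forall>t\<le>T + 1.
           continuous_map (hist_top T cb t) (spa_Y X t) (\<sigma>y t) \<and>
           continuous_map (hist_top T cb t) (spa_Z X t) (\<sigma>z t) \<and>
           (\<forall>h\<in>hists T cb t. \<sigma> t h = (phys_state h, \<sigma>y t h, \<sigma>z t h) \<and> \<sigma> t h \<in> spa_X X t)) \<and>
        (\<forall>h\<in>hists T cb (T + 1). util_end U h = spa_V V (\<sigma> (T + 1) h)) \<and>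
        (\<forall>t\<le>T. \<forall>h\<in>hists T cb t. \<forall>f\<in>plans T cb t. util U t h f = spa_util T X V t (\<sigma> t h) f) \<and>
        (\<forall>t\<le>T. \<forall>h\<in>hists T cb t. \<forall>c\<in>{0..cb}. \<forall>s\<in>states T (Suc t).
           \<sigma> (Suc t) (hext h c s) = spa_trans X t (\<sigma> t h) c s))"

definition spa_represents ::
    "nat \<Rightarrow> real \<Rightarrow> ('s, 'y, 'z) spa_sys \<Rightarrow> ('s, 'y, 'z) spa_rec \<Rightarrow> 's grand_pref \<Rightarrow> bool" where
  "spa_represents T cb X V P \<longleftrightarrow>
     (\<exists>U. utility_system T cb U \<and> compatible T cb P U \<and> spa_factorizes T cb X V U)"

end

theory Submission
  imports Defs
begin

text \<open>
  The belief space is the memory space modulo belief equivalence, the taste space modulo taste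
  equivalence.  The aggregators at fixed arguments are continuous and separate inequivalent
  memories, so both quotients are Hausdorff; exhaustiveness says that the map from PA states to
  triples (state, belief class, taste class) is injective, hence by compactness it is a
  homeomorphism onto its image, along which all the structure is transported.  Each aggregator is
  constant on the classes it is meant to ignore, and it remains jointly continuous on the quotient
  because a continuous surjection from a compact onto a Hausdorff space is proper, so that its
  product with any identity map is again a quotient map.  The same argument yields the continuity
  of the canonical transitions from that of the extension of histories.
\<close>

section \<open>Topological preliminaries\<close>

text \<open>The product of a quotient map with an identity need not be a quotient map. Here
  \<open>q\<close> is proper, properness survives products, and a closed continuous surjection is a
  quotient map. The factor \<open>K\<close> is arbitrary, so that it can hold all remaining
  arguments of an aggregator or transition at once.\<close>

lemma continuous_map_descend_prod:
  assumes "compact_space A" and "Hausdorff_space B"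
    and q: "continuous_map A B q" "q ` topspace A = topspace B"
    and g: "continuous_map (prod_topology A K) N (\<lambda>(a, k). g (q a) k)"
  shows "continuous_map (prod_topology B K) N (\<lambda>(b, k). g b k)"
proof -
  let ?Q = "\<lambda>(a, k). (q a, id k)"
  have "proper_map A B q"
    using assms by (simp add: continuous_imp_proper_map Hausdorff_imp_kc_space)
  then have "proper_map (prod_topology A K) (prod_topology B K) ?Q"
    by (simp only: proper_map_prod proper_map_id simp_thms)
  moreover have "continuous_map (prod_topology A K) (prod_topology B K) ?Q"
    using q(1) by (simp only: continuous_map_prod_top continuous_map_id simp_thms)
  moreover have "?Q ` topspace (prod_topology A K) = topspace (prod_topology B K)"
    using q(2) by force
  ultimately have "quotient_map (prod_topology A K) (prod_topology B K) ?Q"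
    by (simp add: continuous_closed_imp_quotient_map proper_map_def)
  then show ?thesis
    by (rule continuous_compose_quotient_map) (use g in \<open>simp add: o_def case_prod_unfold\<close>)
qed

text \<open>A map constant on classes factors through the quotient, and disjoint neighbourhoods of
  its two values pull back. The target \<open>N\<close> is kept general so that real-valued
  aggregators and the identity map can both serve as \<open>f\<close>.\<close>

lemma quotient_top_separation:
  assumes "equiv (topspace A) R" and "Hausdorff_space N" and f: "continuous_map A N f"
    and R: "\<And>a b. (a, b) \<in> R \<Longrightarrow> f a = f b"
    and ab: "a \<in> topspace A" "b \<in> topspace A" "f a \<noteq> f b"
  shows "\<exists>G H. openin (quotient_top A R) G \<and> openin (quotient_top A R) H \<and>
           R `` {a} \<in> G \<and> R `` {b} \<in> H \<and> disjnt G H"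
proof -
  \<comment> \<open>This is the factor of \<open>f\<close> through the quotient; the chosen element
    does not matter, as \<open>f\<close> is constant on classes.\<close>
  define g where "g p = f (SOME x. x \<in> p)" for p
  have g: "g (R `` {x}) = f x" if "x \<in> topspace A" for x
  proof -
    have "x \<in> R `` {x}" using assms(1) that by (rule equiv_class_self)
    then have "(SOME y. y \<in> R `` {x}) \<in> R `` {x}" by (rule someI)
    then show ?thesis using R by (auto simp: g_def)
  qed
  have "continuous_map A N (g \<circ> (\<lambda>x. R `` {x}))"
    using f by (rule continuous_map_eq) (simp add: g)
  then have cg: "continuous_map (quotient_top A R) N g"
    by (rule continuous_compose_quotient_map[OF quotient_map_quotient_top])
  have "f a \<in> topspace N" "f b \<in> topspace N"
    using f ab by (auto simp: continuous_map_def)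
  then obtain G H where GH: "openin N G" "openin N H" "f a \<in> G" "f b \<in> H" "disjnt G H"
    using assms(2) ab(3) unfolding Hausdorff_space_def by meson
  let ?pre = "\<lambda>S. {p \<in> topspace (quotient_top A R). g p \<in> S}"
  have "R `` {a} \<in> ?pre G" "R `` {b} \<in> ?pre H"
    using GH ab g by (auto simp: quotientI)
  moreover have "disjnt (?pre G) (?pre H)" using GH(5) by (auto simp: disjnt_def)
  moreover have "openin (quotient_top A R) (?pre G)" "openin (quotient_top A R) (?pre H)"
    using openin_continuous_map_preimage[OF cg] GH(1,2) by blast+
  ultimately show ?thesis by blast
qed

text \<open>The separating function may depend on the pair of points, so a family of invariants that
  jointly separates the classes is enough.\<close>

lemma Hausdorff_space_quotient_top:
  assumes R: "equiv (topspace A) R"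
    and sep: "\<And>a b. a \<in> topspace A \<Longrightarrow> b \<in> topspace A \<Longrightarrow> (a, b) \<notin> R \<Longrightarrow>
      \<exists>f :: 'a \<Rightarrow> real. continuous_map A euclideanreal f \<and> (\<forall>(x, y)\<in>R. f x = f y) \<and> f a \<noteq> f b"
  shows "Hausdorff_space (quotient_top A R)"
  unfolding Hausdorff_space_def
proof (intro allI impI, elim conjE)
  fix p q assume "p \<in> topspace (quotient_top A R)" "q \<in> topspace (quotient_top A R)" "p \<noteq> q"
  then obtain a b where ab: "a \<in> topspace A" "b \<in> topspace A" "p = R `` {a}" "q = R `` {b}"
    by (auto elim!: quotientE)
  then have "(a, b) \<notin> R" using R \<open>p \<noteq> q\<close> by (metis equiv_class_eq)
  then obtain f :: "'a \<Rightarrow> real" where "continuous_map A euclideanreal f" "\<forall>(x, y)\<in>R. f x = f y" "f a \<noteq> f b"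
    using sep ab by blast
  then show "\<exists>G H. openin (quotient_top A R) G \<and> openin (quotient_top A R) H \<and>
      p \<in> G \<and> q \<in> H \<and> disjnt G H"
    unfolding ab(3,4) by (intro quotient_top_separation[OF R, of euclideanreal f] ab) auto
qed

lemma Hausdorff_space_quotient_top_Id:
  assumes "Hausdorff_space A" and R: "R = Id_on (topspace A)"
  shows "Hausdorff_space (quotient_top A R)"
  unfolding Hausdorff_space_def
proof (intro allI impI, elim conjE)
  have eq: "equiv (topspace A) R" unfolding R by (auto simp: equiv_def refl_on_def sym_def trans_def)
  fix p q assume "p \<in> topspace (quotient_top A R)" "q \<in> topspace (quotient_top A R)" "p \<noteq> q"
  then obtain a b where ab: "a \<in> topspace A" "b \<in> topspace A" "p = R `` {a}" "q = R `` {b}"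
    by (auto elim!: quotientE)
  then show "\<exists>G H. openin (quotient_top A R) G \<and> openin (quotient_top A R) H \<and>
      p \<in> G \<and> q \<in> H \<and> disjnt G H"
    using quotient_top_separation[OF eq assms(1), of id a b] \<open>p \<noteq> q\<close> R by auto
qed

section \<open>Histories\<close>

lemma topspace_state_top [simp]: "topspace (state_top T t) = states T t"
  by (simp add: state_top_def)

lemma Hausdorff_space_state_top: "Hausdorff_space (state_top T t)"
  by (simp add: state_top_def Hausdorff_space_discrete_topology)

lemma compact_space_state_top: "compact_space (state_top T t :: ('s::finite) pstate topology)"
  by (simp add: state_top_def compact_space_discrete_topology states_def)

lemma phys_state_hext: "s \<in> states T (Suc t) \<Longrightarrow> phys_state (hext h c s) = s"
  by (auto simp: states_def split: if_splits)

text \<open>History topologies are pullbacks along the destructors, so it suffices that the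
  destructors after \<open>hext\<close> are continuous. They only rearrange coordinates, apart from
  stripping \<open>Phys\<close> off a discrete state.\<close>

lemma continuous_map_hext:
  assumes "t \<le> T"
  shows "continuous_map
           (prod_topology (hist_top T cb t) (prod_topology (cons_top cb) (state_top T (Suc t))))
           (hist_top T cb (Suc t)) (\<lambda>(h, c, s). hext h c s)"
    (is "continuous_map ?D _ ?e")
proof (cases "t < T")
  case True
  \<comment> \<open>Before the horizon every next state has the form \<open>Phys x\<close>; the
    other branches of the case expression are never reached.\<close>
  have h: "hext h c s = Step h c (case s of Phys x \<Rightarrow> x)" if "s \<in> states T (Suc t)" for h c and s :: "'a pstate"
    using that True by (auto simp: states_def)
  have *: "continuous_map (state_top T (Suc t)) (discrete_topology UNIV)
      (\<lambda>s. case s of Phys x \<Rightarrow> x)"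
    by (simp add: state_top_def)
  have "continuous_map ?D (prod_topology (hist_top T cb t)
      (prod_topology (cons_top cb) (discrete_topology UNIV)))
      (\<lambda>(h, c, s). (h, c, case s of Phys x \<Rightarrow> x))"
    unfolding case_prod_unfold
    by (intro continuous_map_pairedI continuous_map_compose[OF _ *, unfolded o_def]
        continuous_map_fst continuous_map_compose[OF continuous_map_snd continuous_map_fst, unfolded o_def]
        continuous_map_compose[OF continuous_map_snd continuous_map_snd, unfolded o_def])
  then have "continuous_map ?D (prod_topology (hist_top T cb t)
      (prod_topology (cons_top cb) (discrete_topology UNIV)))
      ((\<lambda>h. (prev h, hcons h, hstate h)) \<circ> ?e)"
    by (rule continuous_map_eq) (auto simp: h)
  then show ?thesis using True
    by (auto intro!: continuous_map_pullback' simp: h)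
next
  case False
  have h: "hext h c s = Final h c" if "s \<in> states T (Suc t)" for h c and s :: "'a pstate"
    using that False by (auto simp: states_def)
  have "continuous_map ?D (prod_topology (hist_top T cb t) (cons_top cb)) (\<lambda>(h, c, s). (h, c))"
    unfolding case_prod_unfold
    by (intro continuous_map_pairedI continuous_map_fst
        continuous_map_compose[OF continuous_map_snd continuous_map_fst, unfolded o_def])
  then have "continuous_map ?D (prod_topology (hist_top T cb t) (cons_top cb))
      ((\<lambda>h. (prev h, hcons h)) \<circ> ?e)"
    by (rule continuous_map_eq) (auto simp: h)
  then show ?thesis using False
    by (auto intro!: continuous_map_pullback' simp: h)
qed

text \<open>Both kinds of extension, \<open>Step\<close> and \<open>Final\<close>, are covered by
  one formula, so that inductions over dates need no case split at the horizon.\<close>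

lemma hists_Suc_eq_image_hext:
  assumes "t \<le> T"
  shows "(hists T cb (Suc t) :: 's hist set) =
    (\<lambda>(h, c, s). hext h c s) ` (hists T cb t \<times> {0..cb} \<times> states T (Suc t))"
proof (cases "t < T")
  case True
  have "Step h c s \<in> (\<lambda>(h, c, s). hext h c s) ` (hists T cb t \<times> {0..cb} \<times> states T (Suc t))"
    if "h \<in> hists T cb t" "c \<in> {0..cb}" for h c and s :: 's
    by (rule image_eqI[of _ _ "(h, c, Phys s)"]) (use that True in \<open>auto simp: states_def\<close>)
  moreover have "hext h c s \<in> hists T cb (Suc t)"
    if "h \<in> hists T cb t" "c \<in> {0..cb}" "s \<in> states T (Suc t)" for h c and s :: "'s pstate"
    using that True unfolding hists_Suc[OF True] by (auto simp: states_def)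
  ultimately show ?thesis unfolding hists_Suc[OF True] by (intro subset_antisym) auto
next
  case False
  then have "t = T" using assms by simp
  moreover have "(states T (Suc T) :: 's pstate set) = {Star}" by (simp add: states_def)
  ultimately show ?thesis by (auto simp only: hists_end) (force intro!: rev_image_eqI)+
qed

lemma hists_nonempty: "0 \<le> cb \<Longrightarrow> t \<le> T + 1 \<Longrightarrow> hists T cb t \<noteq> {}"
proof (induction t)
  case (Suc t)
  have "states T (Suc t) \<noteq> {}" by (simp add: states_def)
  with Suc show ?case by (simp only: hists_Suc_eq_image_hext) auto
qed simp

text \<open>Each history space is the continuous image under \<open>hext\<close> of a product of
  compact spaces; finiteness of the state type makes the discrete factor compact.\<close>

lemma compact_space_hist_top:
  "t \<le> T + 1 \<Longrightarrow> compact_space (hist_top T cb t :: ('s::finite) hist topology)"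
proof (induction t)
  case 0
  show ?case by (simp add: compact_space_discrete_topology)
next
  case (Suc t)
  let ?D = "prod_topology (hist_top T cb t :: 's hist topology)
    (prod_topology (cons_top cb) (state_top T (Suc t) :: 's pstate topology))"
  have "compact_space ?D"
    using Suc by (simp add: compact_space_prod_topology compact_space_state_top cons_top_def
        compact_space_subtopology)
  then have "compactin ?D (topspace ?D)" by (simp add: compact_space_def)
  then have "compactin (hist_top T cb (Suc t)) ((\<lambda>(h, c, s). hext h c s) ` topspace ?D)"
    using Suc.prems by (intro image_compactin[OF _ continuous_map_hext]) auto
  then show ?case
    using Suc.prems unfolding compact_space_def
    by (simp only: hists_Suc_eq_image_hext topspace_prod_topology topspace_cons_top
        topspace_state_top)
qed


section \<open>Splitting the memory into beliefs and tastes\<close>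

text \<open>The canonical system is abstracted to an arbitrary one whose summary maps are onto.
  Compactness and metrizability of its spaces and continuity of its transitions are derived inside
  the locale.\<close>

locale rectangular_pa =
  fixes T :: nat and cb :: real and X :: "('s::finite, 'x) pa_sys" and V :: "('s, 'x) pa_rec"
    and U :: "'s utility" and \<sigma> :: "nat \<Rightarrow> 's hist \<Rightarrow> 'x"
    and Mem :: "nat \<Rightarrow> 'm topology" and \<kappa> :: "nat \<Rightarrow> 'x \<Rightarrow> 's pstate \<times> 'm"
  assumes cb: "0 \<le> cb"
    and recursive: "pa_recursive_structure T cb X V"
    and factorizes: "pa_factorizes T cb X V U \<sigma>"
    and surj: "\<And>t. t \<le> T + 1 \<Longrightarrow> \<sigma> t ` hists T cb t = topspace (pa_space X t)"
    and rectangular: "rectangularization T X Mem \<kappa>"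
    and exhaustive: "aggregator_exhaustive T cb X V Mem \<kappa>"
begin

section \<open>Coordinates and transitions of PA states\<close>

lemma
  assumes "t \<le> T + 1"
  shows homeomorphic_\<kappa>: "homeomorphic_map (pa_space X t) (prod_topology (state_top T t) (Mem t)) (\<kappa> t)"
    and compact_Mem: "compact_space (Mem t)"
    and metrizable_Mem: "metrizable_space (Mem t)"
    and fst_\<kappa>: "x \<in> topspace (pa_space X t) \<Longrightarrow> fst (\<kappa> t x) = pa_state X t x"
  using rectangular assms by (auto simp: rectangularization_def)

text \<open>Both properties hold for the product of states and memories and come back along
  \<open>\<kappa>\<close>.\<close>

lemma
  assumes "t \<le> T + 1"
  shows compact_pa_space: "compact_space (pa_space X t)"
    and metrizable_pa_space: "metrizable_space (pa_space X t)"
proof -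
  have hom: "pa_space X t homeomorphic_space prod_topology (state_top T t :: 's pstate topology) (Mem t)"
    unfolding homeomorphic_space using homeomorphic_\<kappa>[OF assms] by blast
  show "compact_space (pa_space X t)"
    unfolding homeomorphic_compact_space[OF hom]
    by (simp add: compact_space_prod_topology compact_space_state_top compact_Mem[OF assms])
  have "metrizable_space (state_top T t :: 's pstate topology)"
    by (simp add: state_top_def metrizable_space_discrete_topology)
  then show "metrizable_space (pa_space X t)"
    unfolding homeomorphic_metrizable_space[OF hom]
    by (simp add: metrizable_space_prod_topology metrizable_Mem[OF assms])
qed

lemma Hausdorff_pa_space: "t \<le> T + 1 \<Longrightarrow> Hausdorff_space (pa_space X t)"
  by (simp add: metrizable_imp_Hausdorff_space metrizable_pa_space)

lemma \<kappa>_image: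
  "t \<le> T + 1 \<Longrightarrow> \<kappa> t ` topspace (pa_space X t) = states T t \<times> topspace (Mem t)"
  using homeomorphic_imp_surjective_map[OF homeomorphic_\<kappa>] by simp

lemma
  assumes "t \<le> T + 1" and "x \<in> topspace (pa_space X t)"
  shows fst_\<kappa>_in: "fst (\<kappa> t x) \<in> states T t" and snd_\<kappa>_in: "snd (\<kappa> t x) \<in> topspace (Mem t)"
    and rect_inv_\<kappa>: "rect_inv X \<kappa> t (fst (\<kappa> t x)) (snd (\<kappa> t x)) = x"
proof -
  have "\<kappa> t x \<in> states T t \<times> topspace (Mem t)" using \<kappa>_image assms by blast
  then show "fst (\<kappa> t x) \<in> states T t" "snd (\<kappa> t x) \<in> topspace (Mem t)" by auto
  show "rect_inv X \<kappa> t (fst (\<kappa> t x)) (snd (\<kappa> t x)) = x"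
    using homeomorphic_imp_injective_map[OF homeomorphic_\<kappa>[OF assms(1)]] assms(2)
    by (simp add: rect_inv_def inv_into_f_f)
qed

lemma
  assumes "t \<le> T + 1" and "s \<in> states T t" and "m \<in> topspace (Mem t)"
  shows rect_inv_in: "rect_inv X \<kappa> t s m \<in> topspace (pa_space X t)"
    and \<kappa>_rect_inv: "\<kappa> t (rect_inv X \<kappa> t s m) = (s, m)"
  using \<kappa>_image[OF assms(1)] assms(2,3) unfolding rect_inv_def
  by (auto intro: inv_into_into f_inv_into_f)

text \<open>\<open>rect_inv\<close> is given by \<open>inv_into\<close>, from which continuity
  cannot be read off; it agrees with a slice of the continuous inverse of the homeomorphism.\<close>

lemma continuous_map_rect_inv:
  assumes "t \<le> T + 1" and "s \<in> states T t"
  shows "continuous_map (Mem t) (pa_space X t) (rect_inv X \<kappa> t s)"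
proof -
  obtain g where "homeomorphic_maps (pa_space X t) (prod_topology (state_top T t) (Mem t)) (\<kappa> t) g"
    using homeomorphic_\<kappa>[OF assms(1)] by (auto simp: homeomorphic_map_maps)
  then have g: "continuous_map (prod_topology (state_top T t) (Mem t)) (pa_space X t) g"
    and g\<kappa>: "\<And>x. x \<in> topspace (pa_space X t) \<Longrightarrow> g (\<kappa> t x) = x"
    by (auto simp: homeomorphic_maps_def)
  have "continuous_map (Mem t) (pa_space X t) (g \<circ> (\<lambda>m. (s, m)))"
    using assms(2) by (intro continuous_map_compose[OF _ g] continuous_map_pairedI) auto
  then show ?thesis
    by (rule continuous_map_eq)
      (metis assms comp_apply g\<kappa> rect_inv_in \<kappa>_rect_inv)
qed

lemma
  assumes "t < T"
  shows continuous_pa_W: "continuous_map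
      (prod_topology (pa_space X t) (prod_topology (cons_top cb) euclideanreal))
      euclideanreal (\<lambda>(x, c, v). pa_W V t x c v)"
    and continuous_pa_M: "continuous_map (prod_topology (pa_space X t) lvec_top)
      euclideanreal (\<lambda>(x, u). pa_M V t x u)"
  using recursive assms by (auto simp: pa_recursive_structure_def)

text \<open>Every PA state summarizes some history, and summaries commute with extension, so both
  claims reduce to facts about \<open>hext\<close>.\<close>

lemma
  assumes "t \<le> T" "x \<in> topspace (pa_space X t)" "c \<in> {0..cb}" "s \<in> states T (Suc t)"
  shows pa_trans_in: "pa_trans X t x c s \<in> topspace (pa_space X (Suc t))"
    and pa_state_pa_trans: "pa_state X (Suc t) (pa_trans X t x c s) = s"
proof -
  obtain h where h: "h \<in> hists T cb t" "x = \<sigma> t h" using surj[of t] assms(1,2) by auto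
  then have eq: "pa_trans X t x c s = \<sigma> (Suc t) (hext h c s)"
    using factorizes assms by (simp add: pa_factorizes_def)
  have *: "hext h c s \<in> hists T cb (Suc t)"
    unfolding hists_Suc_eq_image_hext[OF assms(1)] using h assms by force
  then show "pa_trans X t x c s \<in> topspace (pa_space X (Suc t))"
    using eq surj[of "Suc t"] assms(1) by auto
  show "pa_state X (Suc t) (pa_trans X t x c s) = s"
    using factorizes * assms(1,4) unfolding eq
    by (simp add: pa_factorizes_def phys_state_hext[OF assms(4)] del: hist_top.simps)
qed

text \<open>On histories the transition is \<open>\<sigma>\<close> after \<open>hext\<close>, which
  is continuous; this descends along the surjection \<open>\<sigma>\<close>.\<close>

lemma continuous_pa_trans:
  assumes "t \<le> T"
  shows "continuous_map
    (prod_topology (pa_space X t) (prod_topology (cons_top cb) (state_top T (Suc t))))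
    (pa_space X (Suc t)) (\<lambda>(x, c, s). pa_trans X t x c s)"
proof -
  let ?D = "prod_topology (hist_top T cb t) (prod_topology (cons_top cb) (state_top T (Suc t)))"
  have \<sigma>: "continuous_map (hist_top T cb t') (pa_space X t') (\<sigma> t')" if "t' \<le> T + 1" for t'
    using factorizes that by (simp add: pa_factorizes_def)
  have "continuous_map ?D (pa_space X (Suc t)) (\<sigma> (Suc t) \<circ> (\<lambda>(h, c, s). hext h c s))"
    by (rule continuous_map_compose[OF continuous_map_hext \<sigma>]) (use assms in auto)
  then have "continuous_map ?D (pa_space X (Suc t)) (\<lambda>(h, c, s). pa_trans X t (\<sigma> t h) c s)"
    by (rule continuous_map_eq) (use factorizes assms in \<open>auto simp: pa_factorizes_def\<close>)
  then show ?thesis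
    using continuous_map_descend_prod[OF compact_space_hist_top Hausdorff_pa_space \<sigma> surj,
        of t "prod_topology (cons_top cb) (state_top T (Suc t))" "pa_space X (Suc t)"
          "\<lambda>x (c, s). pa_trans X t x c s"] assms by simp
qed

section \<open>Belief and taste classes of memories\<close>

text \<open>From date \<open>T\<close> on this is the full relation, while \<open>zrel\<close> is
  equality: the whole memory is then carried by the taste coordinate.\<close>

definition yrel :: "nat \<Rightarrow> ('m \<times> 'm) set" where
  "yrel t = {(m, m'). m \<in> topspace (Mem t) \<and> m' \<in> topspace (Mem t) \<and> belief_equiv T X V \<kappa> t m m'}"

definition zrel :: "nat \<Rightarrow> ('m \<times> 'm) set" where
  "zrel t = {(m, m'). m \<in> topspace (Mem t) \<and> m' \<in> topspace (Mem t) \<and> taste_equiv T cb X V \<kappa> t m m'}"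

lemma equiv_yrel: "equiv (topspace (Mem t)) (yrel t)"
  by (auto simp: equiv_def refl_on_def sym_def trans_def yrel_def belief_equiv_def split: if_splits)

lemma equiv_zrel: "equiv (topspace (Mem t)) (zrel t)"
  by (auto simp: equiv_def refl_on_def sym_def trans_def zrel_def taste_equiv_def split: if_splits)

text \<open>Failure of belief equivalence supplies a state \<open>s\<close> and a vector
  \<open>u\<close> at which the aggregators differ; with these fixed, the aggregator is a continuous
  function of memory that is constant on belief classes.\<close>

lemma Hausdorff_yspace:
  assumes "t \<le> T + 1"
  shows "Hausdorff_space (quotient_top (Mem t) (yrel t))"
proof (rule Hausdorff_space_quotient_top[OF equiv_yrel])
  fix a b assume ab: "a \<in> topspace (Mem t)" "b \<in> topspace (Mem t)" "(a, b) \<notin> yrel t"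
  \<comment> \<open>The relation is full from date \<open>T\<close> on, so an unrelated pair forces
    \<open>t < T\<close>.\<close>
  then obtain s u where "t < T" and s: "s \<in> states T t"
    and ne: "pa_M V t (rect_inv X \<kappa> t s a) u \<noteq> pa_M V t (rect_inv X \<kappa> t s b) u"
    by (auto simp: yrel_def belief_equiv_def split: if_splits)
  let ?f = "\<lambda>m. pa_M V t (rect_inv X \<kappa> t s m) u"
  have "continuous_map (Mem t) euclideanreal
      ((\<lambda>(x, u). pa_M V t x u) \<circ> (\<lambda>m. (rect_inv X \<kappa> t s m, u)))"
    by (rule continuous_map_compose[OF _ continuous_pa_M[OF \<open>t < T\<close>]])
      (use continuous_map_rect_inv[OF assms s] in \<open>auto simp: continuous_map_pairwise o_def lvec_top_def\<close>)
  then have "continuous_map (Mem t) euclideanreal ?f" by (simp add: o_def)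
  moreover have "\<forall>(x, y)\<in>yrel t. ?f x = ?f y"
    using \<open>t < T\<close> s by (auto simp: yrel_def belief_equiv_def)
  ultimately show "\<exists>f :: 'm \<Rightarrow> real. continuous_map (Mem t) euclideanreal f \<and>
      (\<forall>(x, y)\<in>yrel t. f x = f y) \<and> f a \<noteq> f b"
    using ne by blast
qed

lemma Hausdorff_zspace:
  assumes "t \<le> T + 1"
  shows "Hausdorff_space (quotient_top (Mem t) (zrel t))"
proof (cases "t < T")
  case True
  show ?thesis
  proof (rule Hausdorff_space_quotient_top[OF equiv_zrel])
    fix a b assume ab: "a \<in> topspace (Mem t)" "b \<in> topspace (Mem t)" "(a, b) \<notin> zrel t"
    then obtain s c v where s: "s \<in> states T t" and c: "c \<in> {0..cb}"
      and ne: "pa_W V t (rect_inv X \<kappa> t s a) c v \<noteq> pa_W V t (rect_inv X \<kappa> t s b) c v"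
      using True by (auto simp: zrel_def taste_equiv_def)
    let ?f = "\<lambda>m. pa_W V t (rect_inv X \<kappa> t s m) c v"
    have "continuous_map (Mem t) euclideanreal
        ((\<lambda>(x, c, v). pa_W V t x c v) \<circ> (\<lambda>m. (rect_inv X \<kappa> t s m, c, v)))"
      by (rule continuous_map_compose[OF _ continuous_pa_W[OF True]])
        (use continuous_map_rect_inv[OF assms s] c in \<open>auto simp: continuous_map_pairwise o_def\<close>)
    then have "continuous_map (Mem t) euclideanreal ?f" by (simp add: o_def)
    moreover have "\<forall>(x, y)\<in>zrel t. ?f x = ?f y"
      using True s c by (auto simp: zrel_def taste_equiv_def)
    ultimately show "\<exists>f :: 'm \<Rightarrow> real. continuous_map (Mem t) euclideanreal f \<and>
        (\<forall>(x, y)\<in>zrel t. f x = f y) \<and> f a \<noteq> f b"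
      using ne by blast
  qed
next
  case False
  \<comment> \<open>There is no \<open>W\<close> to separate points at these dates, but the relation
    is equality and the memory space itself is Hausdorff.\<close>
  show ?thesis
    by (rule Hausdorff_space_quotient_top_Id)
      (use assms False in \<open>auto simp: metrizable_imp_Hausdorff_space metrizable_Mem zrel_def taste_equiv_def\<close>)
qed

section \<open>The split system and its aggregators\<close>

definition split :: "nat \<Rightarrow> 'x \<Rightarrow> 's pstate \<times> 'm set \<times> 'm set" where
  "split t x = (fst (\<kappa> t x), yrel t `` {snd (\<kappa> t x)}, zrel t `` {snd (\<kappa> t x)})"

definition unsplit :: "nat \<Rightarrow> 's pstate \<times> 'm set \<times> 'm set \<Rightarrow> 'x" where
  "unsplit t = inv_into (topspace (pa_space X t)) (split t)"

text \<open>The carrier is the image of \<open>split\<close>, which may be smaller than the full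
  product: a belief class and a taste class occur together only if they share a memory. Transitions
  are conjugated by \<open>split\<close>.\<close>

definition split_sys :: "('s, 'm set, 'm set) spa_sys" where
  "split_sys =
     \<lparr> spa_Y = (\<lambda>t. quotient_top (Mem t) (yrel t)),
       spa_Z = (\<lambda>t. quotient_top (Mem t) (zrel t)),
       spa_X = (\<lambda>t. split t ` topspace (pa_space X t)),
       spa_state = (\<lambda>t. fst),
       spa_trans = (\<lambda>t \<xi> c s. split (Suc t) (pa_trans X t (unsplit t \<xi>) c s)) \<rparr>"

text \<open>Rectangularity enters here: a representative memory of a class can be combined with any
  current state \<open>s\<close> to give a PA state, whichever state it was observed with.\<close>

definition split_rec :: "('s, 'm set, 'm set) spa_rec" where
  "split_rec =
     \<lparr> spa_W = (\<lambda>t (s, z). pa_W V t (rect_inv X \<kappa> t s (SOME m. m \<in> z))),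
       spa_M = (\<lambda>t (s, y). pa_M V t (rect_inv X \<kappa> t s (SOME m. m \<in> y))),
       spa_V = (\<lambda>\<xi>. pa_V V (unsplit (T + 1) \<xi>)) \<rparr>"

lemma split_sys_simps [simp]:
  "spa_Y split_sys t = quotient_top (Mem t) (yrel t)"
  "spa_Z split_sys t = quotient_top (Mem t) (zrel t)"
  "spa_X split_sys t = split t ` topspace (pa_space X t)"
  "spa_state split_sys t = fst"
  "spa_trans split_sys t \<xi> c s = split (Suc t) (pa_trans X t (unsplit t \<xi>) c s)"
  "spa_V split_rec \<xi> = pa_V V (unsplit (T + 1) \<xi>)"
  by (simp_all add: split_sys_def split_rec_def)

text \<open>Equal triples have memories that are both belief and taste equivalent, hence equal by
  exhaustiveness; state and memory together determine the PA state.\<close>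

lemma inj_on_split:
  assumes "t \<le> T + 1"
  shows "inj_on (split t) (topspace (pa_space X t))"
proof (rule inj_onI)
  fix x x' assume x: "x \<in> topspace (pa_space X t)" "x' \<in> topspace (pa_space X t)"
    and eq: "split t x = split t x'"
  have m: "snd (\<kappa> t x) \<in> topspace (Mem t)" "snd (\<kappa> t x') \<in> topspace (Mem t)"
    using snd_\<kappa>_in assms x by auto
  have "(snd (\<kappa> t x), snd (\<kappa> t x')) \<in> yrel t" "(snd (\<kappa> t x), snd (\<kappa> t x')) \<in> zrel t"
    using eq m by (auto simp: split_def intro: eq_equiv_class[OF _ equiv_yrel] eq_equiv_class[OF _ equiv_zrel])
  then have "snd (\<kappa> t x) = snd (\<kappa> t x')"
    using exhaustive assms by (auto simp: aggregator_exhaustive_def yrel_def zrel_def)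
  moreover have "fst (\<kappa> t x) = fst (\<kappa> t x')" using eq by (simp add: split_def)
  ultimately show "x = x'" using rect_inv_\<kappa>[OF assms] x by metis
qed

lemma unsplit_split: "t \<le> T + 1 \<Longrightarrow> x \<in> topspace (pa_space X t) \<Longrightarrow> unsplit t (split t x) = x"
  by (simp add: unsplit_def inv_into_f_f inj_on_split)

lemma spa_X_split_sys:
  assumes "t \<le> T + 1"
  shows "spa_X split_sys t \<subseteq>
    states T t \<times> topspace (spa_Y split_sys t) \<times> topspace (spa_Z split_sys t)"
  using fst_\<kappa>_in[OF assms] snd_\<kappa>_in[OF assms] by (auto simp: split_def quotientI)

lemma
  assumes "t \<le> T + 1"
  shows continuous_map_fst_\<kappa>: "continuous_map (pa_space X t) (state_top T t) (\<lambda>x. fst (\<kappa> t x))"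
    and continuous_map_yclass: "continuous_map (pa_space X t) (quotient_top (Mem t) (yrel t))
      (\<lambda>x. yrel t `` {snd (\<kappa> t x)})"
    and continuous_map_zclass: "continuous_map (pa_space X t) (quotient_top (Mem t) (zrel t))
      (\<lambda>x. zrel t `` {snd (\<kappa> t x)})"
proof -
  have \<kappa>: "continuous_map (pa_space X t) (prod_topology (state_top T t) (Mem t)) (\<kappa> t)"
    using homeomorphic_\<kappa>[OF assms] by (rule homeomorphic_imp_continuous_map)
  then show "continuous_map (pa_space X t) (state_top T t) (\<lambda>x. fst (\<kappa> t x))"
    by (rule continuous_map_fst_of[unfolded o_def])
  have "continuous_map (pa_space X t) (Mem t) (\<lambda>x. snd (\<kappa> t x))"
    using \<kappa> by (rule continuous_map_snd_of[unfolded o_def])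
  then show "continuous_map (pa_space X t) (quotient_top (Mem t) (yrel t)) (\<lambda>x. yrel t `` {snd (\<kappa> t x)})"
    and "continuous_map (pa_space X t) (quotient_top (Mem t) (zrel t)) (\<lambda>x. zrel t `` {snd (\<kappa> t x)})"
    by (rule continuous_map_compose[OF _ quotient_imp_continuous_map[OF quotient_map_quotient_top],
          unfolded o_def])+
qed

lemma
  assumes "t \<le> T + 1"
  shows Hausdorff_spa_space: "Hausdorff_space (spa_space T split_sys t)"
    and Hausdorff_spa_y_space: "Hausdorff_space (spa_y_space T split_sys t)"
    and Hausdorff_spa_z_space: "Hausdorff_space (spa_z_space T split_sys t)"
  using Hausdorff_yspace[OF assms] Hausdorff_zspace[OF assms]
  by (auto simp: spa_space_def spa_y_space_def spa_z_space_def Hausdorff_space_state_top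
      Hausdorff_space_prod_topology intro!: Hausdorff_space_subtopology)

lemma
  assumes "t \<le> T + 1"
  shows topspace_spa_space: "topspace (spa_space T split_sys t) = split t ` topspace (pa_space X t)"
    and topspace_spa_y_space: "topspace (spa_y_space T split_sys t) =
      (\<lambda>x. (fst (\<kappa> t x), yrel t `` {snd (\<kappa> t x)})) ` topspace (pa_space X t)"
    and topspace_spa_z_space: "topspace (spa_z_space T split_sys t) =
      (\<lambda>x. (fst (\<kappa> t x), zrel t `` {snd (\<kappa> t x)})) ` topspace (pa_space X t)"
  using fst_\<kappa>_in[OF assms] snd_\<kappa>_in[OF assms]
  by (force simp: spa_space_def spa_y_space_def spa_z_space_def split_def quotientI)+

text \<open>A continuous injection of a compact space into a Hausdorff space is a homeomorphism onto
  its image. The quotients are only shown to be Hausdorff, so metrizability of the triples comes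
  from the PA side.\<close>

lemma homeomorphic_map_split:
  assumes "t \<le> T + 1"
  shows "homeomorphic_map (pa_space X t) (spa_space T split_sys t) (split t)"
proof (rule continuous_imp_homeomorphic_map)
  show "continuous_map (pa_space X t) (spa_space T split_sys t) (split t)"
    unfolding spa_space_def split_sys_simps
    by (intro continuous_map_into_subtopology)
      (auto simp: split_def [abs_def] intro!: continuous_map_pairedI continuous_map_fst_\<kappa>
        continuous_map_yclass continuous_map_zclass assms)
qed (use assms in \<open>auto simp: compact_pa_space Hausdorff_spa_space topspace_spa_space inj_on_split\<close>)

text \<open>The representative picked by \<open>SOME\<close> is taste equivalent to the memory of
  \<open>x\<close>, and taste equivalence quantifies over all states, in particular the one of
  \<open>x\<close>.\<close>

lemma spa_W_split_rec:
  assumes "t < T" "x \<in> topspace (pa_space X t)" "c \<in> {0..cb}"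
  shows "spa_W split_rec t (fst (\<kappa> t x), zrel t `` {snd (\<kappa> t x)}) c v = pa_W V t x c v"
proof -
  have t: "t \<le> T + 1" using assms by simp
  let ?m = "SOME m. m \<in> zrel t `` {snd (\<kappa> t x)}"
  have "snd (\<kappa> t x) \<in> zrel t `` {snd (\<kappa> t x)}"
    using equiv_zrel snd_\<kappa>_in[OF t assms(2)] by (rule equiv_class_self)
  then have "?m \<in> zrel t `` {snd (\<kappa> t x)}" by (rule someI)
  then have "taste_equiv T cb X V \<kappa> t (snd (\<kappa> t x)) ?m"
    unfolding zrel_def by blast
  then have "pa_W V t (rect_inv X \<kappa> t (fst (\<kappa> t x)) (snd (\<kappa> t x))) c v =
      pa_W V t (rect_inv X \<kappa> t (fst (\<kappa> t x)) ?m) c v"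
    using assms fst_\<kappa>_in[OF t assms(2)] by (simp add: taste_equiv_def)
  then show ?thesis by (simp add: split_rec_def rect_inv_\<kappa>[OF t assms(2)])
qed

lemma spa_M_split_rec:
  assumes "t < T" "x \<in> topspace (pa_space X t)"
  shows "spa_M split_rec t (fst (\<kappa> t x), yrel t `` {snd (\<kappa> t x)}) u = pa_M V t x u"
proof -
  have t: "t \<le> T + 1" using assms by simp
  let ?m = "SOME m. m \<in> yrel t `` {snd (\<kappa> t x)}"
  have "snd (\<kappa> t x) \<in> yrel t `` {snd (\<kappa> t x)}"
    using equiv_yrel snd_\<kappa>_in[OF t assms(2)] by (rule equiv_class_self)
  then have "?m \<in> yrel t `` {snd (\<kappa> t x)}" by (rule someI)
  then have "belief_equiv T X V \<kappa> t (snd (\<kappa> t x)) ?m"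
    unfolding yrel_def by blast
  then have "pa_M V t (rect_inv X \<kappa> t (fst (\<kappa> t x)) (snd (\<kappa> t x))) u =
      pa_M V t (rect_inv X \<kappa> t (fst (\<kappa> t x)) ?m) u"
    using assms fst_\<kappa>_in[OF t assms(2)] by (simp add: belief_equiv_def)
  then show ?thesis by (simp add: split_rec_def rect_inv_\<kappa>[OF t assms(2)])
qed

section \<open>Verification of the SPA conditions\<close>

lemma spa_state_system_split_sys: "spa_state_system T cb split_sys"
  unfolding spa_state_system_def
proof (intro conjI allI impI ballI)
  fix t assume t: "t \<le> T + 1"
  show "Hausdorff_space (spa_Y split_sys t)" "Hausdorff_space (spa_Z split_sys t)"
    using Hausdorff_yspace[OF t] Hausdorff_zspace[OF t] by simp_all
  show "spa_X split_sys t \<subseteq> states T t \<times> topspace (spa_Y split_sys t) \<times> topspace (spa_Z split_sys t)"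
    using t by (rule spa_X_split_sys)
  show "spa_X split_sys t \<noteq> {}"
    using hists_nonempty[OF cb t] surj[OF t] by auto
  have hom: "pa_space X t homeomorphic_space spa_space T split_sys t"
    unfolding homeomorphic_space using homeomorphic_map_split[OF t] by blast
  show "compact_space (spa_space T split_sys t)" "metrizable_space (spa_space T split_sys t)"
    using compact_pa_space[OF t] metrizable_pa_space[OF t]
    unfolding homeomorphic_compact_space[OF hom] homeomorphic_metrizable_space[OF hom] .
next
  fix t assume t: "t \<le> T"
  then have t': "t \<le> T + 1" "Suc t \<le> T + 1" by auto
  let ?K = "prod_topology (cons_top cb) (state_top T (Suc t))"
  have "continuous_map (prod_topology (pa_space X t) ?K) (spa_space T split_sys (Suc t))
      (split (Suc t) \<circ> (\<lambda>(x, c, s). pa_trans X t x c s))"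
    by (rule continuous_map_compose[OF continuous_pa_trans[OF t]
          homeomorphic_imp_continuous_map[OF homeomorphic_map_split[OF t'(2)]]])
  \<comment> \<open>Writing the map in terms of \<open>split t x\<close> puts it in the form that
    descends along \<open>split t\<close>.\<close>
  then have "continuous_map (prod_topology (pa_space X t) ?K) (spa_space T split_sys (Suc t))
      (\<lambda>(x, c, s). spa_trans split_sys t (split t x) c s)"
    by (rule continuous_map_eq) (use t' in \<open>auto simp: unsplit_split\<close>)
  then show "continuous_map (prod_topology (spa_space T split_sys t) ?K)
      (spa_space T split_sys (Suc t)) (\<lambda>(\<xi>, c, s). spa_trans split_sys t \<xi> c s)"
    using continuous_map_descend_prod[OF compact_pa_space Hausdorff_spa_space
        homeomorphic_imp_continuous_map[OF homeomorphic_map_split]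
        topspace_spa_space[symmetric], OF t'(1) t'(1) t'(1) t'(1),
        where g = "\<lambda>\<xi> (c, s). spa_trans split_sys t \<xi> c s"]
    by simp
  fix \<xi> c and s :: "'s pstate"
  assume "\<xi> \<in> spa_X split_sys t" and c: "c \<in> {0..cb}" and s: "s \<in> states T (Suc t)"
  then obtain x where x: "x \<in> topspace (pa_space X t)" "\<xi> = split t x" by auto
  then show "spa_state split_sys (Suc t) (spa_trans split_sys t \<xi> c s) = s"
    using t t' c s
    by (simp add: unsplit_split split_def[of "Suc t"] fst_\<kappa> pa_trans_in pa_state_pa_trans)
qed simp

lemma spa_recursive_structure_split_rec: "spa_recursive_structure T cb split_sys split_rec"
  unfolding spa_recursive_structure_def
proof (intro conjI allI impI ballI)
  fix t assume t: "t < T"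
  then have t': "t \<le> T + 1" by simp
  let ?y = "\<lambda>x. (fst (\<kappa> t x), yrel t `` {snd (\<kappa> t x)})"
  let ?z = "\<lambda>x. (fst (\<kappa> t x), zrel t `` {snd (\<kappa> t x)})"
  have y: "continuous_map (pa_space X t) (spa_y_space T split_sys t) ?y"
    unfolding spa_y_space_def split_sys_simps
    by (intro continuous_map_into_subtopology continuous_map_pairedI continuous_map_fst_\<kappa>
        continuous_map_yclass t') (force simp: split_def)
  have z: "continuous_map (pa_space X t) (spa_z_space T split_sys t) ?z"
    unfolding spa_z_space_def split_sys_simps
    by (intro continuous_map_into_subtopology continuous_map_pairedI continuous_map_fst_\<kappa>
        continuous_map_zclass t') (force simp: split_def)
  \<comment> \<open>Pulled back along \<open>?z\<close>, the new aggregator is the old one. Unlike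
    \<open>split\<close>, the map \<open>?z\<close> need not be injective, so joint continuity
    relies on descent rather than on a homeomorphism.\<close>
  have "continuous_map (prod_topology (pa_space X t) (prod_topology (cons_top cb) euclideanreal))
      euclideanreal (\<lambda>(x, c, v). spa_W split_rec t (?z x) c v)"
    using continuous_pa_W[OF t]
    by (rule continuous_map_eq) (use t in \<open>auto simp: spa_W_split_rec\<close>)
  then show "continuous_map (prod_topology (spa_z_space T split_sys t)
      (prod_topology (cons_top cb) euclideanreal)) euclideanreal
      (\<lambda>(sz, c, v). spa_W split_rec t sz c v)"
    using continuous_map_descend_prod[OF compact_pa_space[OF t'] Hausdorff_spa_z_space[OF t'] z
        topspace_spa_z_space[OF t', symmetric],
        where g = "\<lambda>sz (c, v). spa_W split_rec t sz c v"] by simp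
  have "continuous_map (prod_topology (pa_space X t) lvec_top)
      euclideanreal (\<lambda>(x, u). spa_M split_rec t (?y x) u)"
    using continuous_pa_M[OF t]
    by (rule continuous_map_eq) (use t in \<open>auto simp: spa_M_split_rec\<close>)
  then show "continuous_map (prod_topology (spa_y_space T split_sys t) lvec_top)
      euclideanreal (\<lambda>(sy, u). spa_M split_rec t sy u)"
    by (rule continuous_map_descend_prod[OF compact_pa_space[OF t'] Hausdorff_spa_y_space[OF t'] y
        topspace_spa_y_space[OF t', symmetric]])
  show "mono (spa_W split_rec t sz c)"
    if "sz \<in> topspace (spa_z_space T split_sys t)" "c \<in> {0..cb}" for sz c
  proof -
    obtain x where x: "x \<in> topspace (pa_space X t)" "sz = ?z x"
      using \<open>sz \<in> _\<close> topspace_spa_z_space[OF t'] by auto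
    then have "mono (pa_W V t x c)"
      using recursive t that(2) by (simp add: pa_recursive_structure_def)
    then show ?thesis
      using spa_W_split_rec[OF t x(1) that(2)] x(2) by (simp add: mono_def)
  qed
  fix sy assume "sy \<in> topspace (spa_y_space T split_sys t)"
  then obtain x where x: "x \<in> topspace (pa_space X t)" "sy = ?y x"
    using topspace_spa_y_space[OF t'] by auto
  then have "mono (pa_M V t x)" "\<And>v. pa_M V t x (\<lambda>_. v) = v"
    using recursive t by (simp_all add: pa_recursive_structure_def)
  then show "mono (spa_M split_rec t sy)" "spa_M split_rec t sy (\<lambda>_. v) = v" for v
    using spa_M_split_rec[OF t x(1)] x(2) by (simp_all add: mono_def)
next
  \<comment> \<open>The continuous inverse \<open>g\<close> agrees with \<open>unsplit\<close> on
    the carrier, which makes \<open>spa_V\<close> continuous.\<close>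
  obtain g where g: "homeomorphic_maps (pa_space X (T + 1)) (spa_space T split_sys (T + 1)) (split (T + 1)) g"
    using homeomorphic_map_split by (auto simp: homeomorphic_map_maps)
  then have "continuous_map (spa_space T split_sys (T + 1)) euclideanreal (pa_V V \<circ> g)"
    using recursive by (auto simp: pa_recursive_structure_def homeomorphic_maps_def intro: continuous_map_compose)
  moreover have "g \<xi> = unsplit (T + 1) \<xi>" if "\<xi> \<in> topspace (spa_space T split_sys (T + 1))" for \<xi>
    using that g unsplit_split[of "T + 1"] by (auto simp: topspace_spa_space homeomorphic_maps_def)
  ultimately show "continuous_map (spa_space T split_sys (T + 1)) euclideanreal (spa_V split_rec)"
    by (elim continuous_map_eq) simp
qed

text \<open>Backward induction on the number \<open>T - t\<close> of remaining dates: the two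
  recursions match term by term, since aggregators and transitions correspond under
  \<open>split\<close>.\<close>

lemma spa_util_split:
  assumes "t \<le> T" "x \<in> topspace (pa_space X t)" "f \<in> plans T cb t"
  shows "spa_util T split_sys split_rec t (split t x) f = pa_util T X V t x f"
  using assms
proof (induction "T - t" arbitrary: t x f)
  case 0
  then have [simp]: "t = T" by simp
  obtain c where "f = last_plan c" "c \<in> {0..cb}" using 0 by (auto simp: plans_T)
  moreover have "(Star :: 's pstate) \<in> states T (Suc T)" by (simp add: states_def)
  \<comment> \<open>The equation of \<open>spa_util\<close> matches only explicit triples, so
    \<open>split\<close> is unfolded to apply it and folded again afterwards.\<close>
  ultimately show ?case
    using 0 unfolding split_def
    by (subst spa_util.simps, subst pa_util.simps)
      (simp add: split_def[symmetric] unsplit_split pa_trans_in)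
next
  case (Suc n)
  then have t: "t < T" "t \<le> T + 1" by auto
  obtain c g where f: "f = Plan c g" "c \<in> {0..cb}" "\<And>s. g s \<in> plans T cb (Suc t)"
    using Suc.prems by (auto simp: plans_step)
  have "spa_util T split_sys split_rec (Suc t) (split (Suc t) (pa_trans X t x c (Phys s))) (g s) =
      pa_util T X V (Suc t) (pa_trans X t x c (Phys s)) (g s)" for s
    using Suc t f by (intro Suc.hyps(1) pa_trans_in) (auto simp: states_def)
  then show ?case
    using t Suc.prems f(1,2) unfolding split_def[of t]
    by (subst spa_util.simps, subst pa_util.simps)
      (simp add: split_def[of t, symmetric] unsplit_split spa_W_split_rec spa_M_split_rec)
qed

lemma spa_factorizes_split: "spa_factorizes T cb split_sys split_rec U"
  unfolding spa_factorizes_def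
proof (intro exI conjI allI impI ballI)
  \<comment> \<open>The summary maps are the classes of the memory of \<open>\<sigma> t h\<close>,
    and the joint summary is \<open>split t (\<sigma> t h)\<close>; the existential witnesses stay
    schematic until the facts below fix them.\<close>
  let ?y = "\<lambda>t h. yrel t `` {snd (\<kappa> t (\<sigma> t h))}"
  let ?z = "\<lambda>t h. zrel t `` {snd (\<kappa> t (\<sigma> t h))}"
  have \<sigma>: "\<sigma> t h \<in> topspace (pa_space X t)" if "t \<le> T + 1" "h \<in> hists T cb t" for t and h :: "'s hist"
    using surj that by blast
  {
    fix t assume t: "t \<le> T + 1"
    then have c: "continuous_map (hist_top T cb t) (pa_space X t) (\<sigma> t)"
      using factorizes by (simp add: pa_factorizes_def)
    show "continuous_map (hist_top T cb t) (spa_Y split_sys t) (?y t)"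
      "continuous_map (hist_top T cb t) (spa_Z split_sys t) (?z t)"
      using continuous_map_compose[OF c continuous_map_yclass[OF t]]
        continuous_map_compose[OF c continuous_map_zclass[OF t]] by (simp_all add: o_def)
    fix h :: "'s hist" assume h: "h \<in> hists T cb t"
    show "split t (\<sigma> t h) = (phys_state h, ?y t h, ?z t h)"
      using factorizes t h \<sigma> by (simp add: split_def fst_\<kappa> pa_factorizes_def)
    show "split t (\<sigma> t h) \<in> spa_X split_sys t" using \<sigma> t h by simp
  }
  show "util_end U h = spa_V split_rec (split (T + 1) (\<sigma> (T + 1) h))" if "h \<in> hists T cb (T + 1)" for h :: "'s hist"
  proof -
    have "unsplit (T + 1) (split (T + 1) (\<sigma> (T + 1) h)) = \<sigma> (T + 1) h"
      using that \<sigma> by (intro unsplit_split) auto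
    then show ?thesis using factorizes that by (simp only: split_sys_simps pa_factorizes_def)
  qed
  fix t assume t: "t \<le> T"
  fix h :: "'s hist" assume h: "h \<in> hists T cb t"
  show "util U t h f = spa_util T split_sys split_rec t (split t (\<sigma> t h)) f" if "f \<in> plans T cb t" for f
    using factorizes t h \<sigma> that by (simp add: spa_util_split pa_factorizes_def)
  show "split (Suc t) (\<sigma> (Suc t) (hext h c s)) = spa_trans split_sys t (split t (\<sigma> t h)) c s"
    if "c \<in> {0..cb}" "s \<in> states T (Suc t)" for c s
    using factorizes t h \<sigma> that by (simp add: unsplit_split pa_factorizes_def)
qed

end

theorem theorem6p14:
  fixes T :: nat and cb :: real
    and P :: "('s::finite) grand_pref" and U :: "'s utility"
    and V :: "('s, 's hist set) pa_rec"
    and Mem :: "nat \<Rightarrow> 'm topology"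
    and \<kappa> :: "nat \<Rightarrow> 's hist set \<Rightarrow> 's pstate \<times> 'm"
  assumes "1 \<le> T" and "0 \<le> cb"
    and "grand_preference T cb P"
    and "weak_order T cb P"
    and "pref_continuity T cb P"
    and "dynamic_consistency T cb P"
    and "terminal_compatibility T cb P"
    and "compensated_monotonicity T cb P"
    and "weak_separability T cb P"
    and "utility_system T cb U"
    and "compatible T cb P U"
    and "ce_richness T cb P U"
    and "pa_recursive_structure T cb (canon_sys T cb P U) V"
    and "pa_factorizes T cb (canon_sys T cb P U) V U (canon_proj T cb P U)"
    and "rectangularization T (canon_sys T cb P U) Mem \<kappa>"
    and "aggregator_exhaustive T cb (canon_sys T cb P U) V Mem \<kappa>"
  shows "\<exists>(X' :: ('s, 'm set, 'm set) spa_sys) (V' :: ('s, 'm set, 'm set) spa_rec).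
           spa_state_system T cb X' \<and>
           spa_recursive_structure T cb X' V' \<and>
           spa_factorizes T cb X' V' U \<and>
           spa_represents T cb X' V' P"
proof -
  interpret rectangular_pa T cb "canon_sys T cb P U" V U "canon_proj T cb P U" Mem \<kappa>
  proof
    \<comment> \<open>Points of the quotient are classes of histories, so the projection is
      onto.\<close>
    show "canon_proj T cb P U t ` hists T cb t = topspace (pa_space (canon_sys T cb P U) t)" for t
      by (auto simp: canon_sys_def canon_proj_def quotient_def)
  qed (use assms in auto)
  \<comment> \<open>The given \<open>U\<close> itself is the compatible system that witnesses the
    representation.\<close>
  have "spa_represents T cb split_sys split_rec P"
    unfolding spa_represents_def using assms spa_factorizes_split by blast
  then show ?thesis
    using spa_state_system_split_sys spa_recursive_structure_split_rec spa_factorizes_split by blast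
qed

end
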